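(* If $f_1,f_2$ are nonzero relatively prime elements of $F_{\mathbb Z^2}$, then \[ |\operatorname{sm}(f_1)|\,|\operatorname{sm}(f_2)|\le 2\operatorname{vol}(\operatorname{NP}(f_1),\operatorname{NP}(f_2)). \]
   Context: $F_{\mathbb Z^2}$ is the ring of finitely supported functions $f:\mathbb Z^2\to\mathbb R$ with pointwise addition and convolution product $(f*g)(c)=\sum_{a+b=c}f(a)g(b)$; it is isomorphic to the Laurent polynomial ring $\mathbb R[X_1^{\pm1},X_2^{\pm1}]$, hence a unique factorization domain. $\operatorname{NP}(f)$ is the convex hull of $\operatorname{supp}(f)$. $\mathbb N$ is the set of nonnegative integers; for $e\in\mathbb N^2$, $|e|=e_1+e_2$. Monomials $X^e=X_1^{e_1}X_2^{e_2}$ are ordered degree-lexicographically with $X_1<X_2$: $X^e<X^{e'}$ iff $|e|<|e'|$, or $|e|=|e'|$ and $e_2<e_2'$. For $f\ne0$, $\operatorname{sm}(f)\in\mathbb N^2$ is the exponent such that $X^{\operatorname{sm}(f)}$ is the smallest monomial $X^e$ with $\sum_{a\in\mathbb Z^2}f(a)a^e\neq0$, where $a^e=a_1^{e_1}a_2^{e_2}$. For compact convex sets $P,Q\subset\mathbb R^2$, the mixed volume $\operatorname{vol}(P,Q)$ is defined by $\operatorname{vol}(P+Q)=\operatorname{vol}(P)+\operatorname{vol}(Q)+2\operatorname{vol}(P,Q)$, where $P+Q$ is the Minkowski sum and $\operatorname{vol}$ of a single set is area. *)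

theory Defs
  imports "HOL-Analysis.Analysis" "HOL-Library.Poly_Mapping"
begin

text \<open>
  Finitely supported functions on \<open>\<int>\<^sup>2\<close> with pointwise addition and convolution product are
  \<^typ>\<open>(int \<times> int) \<Rightarrow>\<^sub>0 real\<close>; the support of \<open>f\<close> is \<open>keys f\<close> and the value at \<open>a\<close> is
  \<open>lookup f a\<close>.
\<close>

type_synonym FZ2 = "(int \<times> int) \<Rightarrow>\<^sub>0 real"

text \<open>
  The library's constant \<open>coprime\<close> requires the class \<open>algebraic_semidom\<close>, which this ring is not
  an instance of (there is no division operation on it); this is the same definition for an
  arbitrary commutative ring.
\<close>

definition rel_prime :: "'a::comm_ring_1 \<Rightarrow> 'a \<Rightarrow> bool" where
  "rel_prime f g \<longleftrightarrow> (\<forall>h. h dvd f \<longrightarrow> h dvd g \<longrightarrow> h dvd 1)"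

definition newton_polytope :: "FZ2 \<Rightarrow> (real \<times> real) set" where
  "newton_polytope f = convex hull ((\<lambda>a. (real_of_int (fst a), real_of_int (snd a))) ` Poly_Mapping.keys f)"

definition exp_deg :: "nat \<times> nat \<Rightarrow> nat" where
  "exp_deg e = fst e + snd e"

definition monom_less :: "nat \<times> nat \<Rightarrow> nat \<times> nat \<Rightarrow> bool" where
  "monom_less e e' \<longleftrightarrow> exp_deg e < exp_deg e' \<or> exp_deg e = exp_deg e' \<and> snd e < snd e'"

text \<open>As usual \<open>0\<^sup>0 = 1\<close> here.\<close>

definition moment :: "FZ2 \<Rightarrow> nat \<times> nat \<Rightarrow> real" where
  "moment f e =
     (\<Sum>a\<in>Poly_Mapping.keys f. Poly_Mapping.lookup f a * (real_of_int (fst a) ^ fst e * real_of_int (snd a) ^ snd e))"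

text \<open>Only meaningful for \<open>f \<noteq> 0\<close>: all moments of \<open>0\<close> vanish.\<close>

definition sm :: "FZ2 \<Rightarrow> nat \<times> nat" where
  "sm f = (THE e. moment f e \<noteq> 0 \<and> (\<forall>e'. moment f e' \<noteq> 0 \<longrightarrow> e = e' \<or> monom_less e e'))"

text \<open>\<open>P + Q\<close> is the Minkowski sum. Only meaningful for compact convex sets.\<close>

definition mixed_volume :: "(real \<times> real) set \<Rightarrow> (real \<times> real) set \<Rightarrow> real" where
  "mixed_volume P Q = (measure lebesgue (P + Q) - measure lebesgue P - measure lebesgue Q) / 2"

end

theory Submission
  imports Defs "HOL-Computational_Algebra.Polynomial_Factorial" "HOL-Computational_Algebra.Field_as_Ring"
begin

text \<open>
  The vanishing of all moments of order less than \<open>m\<close> says that the Laurent polynomial \<open>f\<close> vanishes to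
  order \<open>m\<close> at \<open>(1, 1)\<close>, so the claim bounds a local intersection number from below by \<open>m\<^sub>1 m\<^sub>2\<close>
  and from above by the mixed area. Let \<open>P\<close> and \<open>Q\<close> be the Newton polytopes, \<open>B\<close> a square of side
  \<open>m\<^sub>1 + m\<^sub>2\<close>, and \<open>A(X)\<close> the space of functions supported on the lattice points of \<open>X\<close>. The map
  \<open>(g\<^sub>1, g\<^sub>2) \<mapsto> f\<^sub>1 g\<^sub>1 + f\<^sub>2 g\<^sub>2\<close> from \<open>A(Q + B) \<times> A(P + B)\<close> to \<open>A(P + Q + B)\<close> has kernel
  isomorphic to \<open>A(B)\<close>, since \<open>f\<^sub>1\<close> and \<open>f\<^sub>2\<close> are relatively prime; its image has codimension at
  least \<open>m\<^sub>1 m\<^sub>2\<close>, because modulo functions vanishing to order \<open>m\<^sub>1 + m\<^sub>2\<close> the product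
  \<open>f\<^sub>i g\<^sub>i\<close> depends only on the low moments of \<open>g\<^sub>i\<close>. Hence \<open>m\<^sub>1 m\<^sub>2\<close> is at most a second difference
  of lattice point counts. Applying this to \<open>f\<^sub>1\<^sup>k\<close> and \<open>f\<^sub>2\<^sup>k\<close>, dividing by \<open>k\<^sup>2\<close> and letting
  \<open>k\<close> tend to infinity turns the counts into areas, and the resulting second difference of areas does
  not depend on \<open>B\<close>.
\<close>

section \<open>Linear functionals on finitely supported functions\<close>

abbreviation lookup where "lookup \<equiv> Poly_Mapping.lookup"
abbreviation keys where "keys \<equiv> Poly_Mapping.keys"
abbreviation single where "single \<equiv> Poly_Mapping.single"

text \<open>Coefficients and moments both have this form, so additivity and the expansion over
  products are proved once for all weights \<open>\<phi>\<close>.\<close>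

definition pairing :: "('a \<Rightarrow> real) \<Rightarrow> ('a \<Rightarrow>\<^sub>0 real) \<Rightarrow> real" where
  "pairing \<phi> f = (\<Sum>a\<in>keys f. lookup f a * \<phi> a)"

lemma pairing_superset:
  assumes "finite A" "keys f \<subseteq> A"
  shows "pairing \<phi> f = (\<Sum>a\<in>A. lookup f a * \<phi> a)"
  unfolding pairing_def by (rule sum.mono_neutral_left) (use assms in \<open>auto simp: in_keys_iff\<close>)

lemma pairing_0 [simp]: "pairing \<phi> 0 = 0"
  by (simp add: pairing_def)

lemma pairing_add: "pairing \<phi> (f + g) = pairing \<phi> f + pairing \<phi> g"
proof -
  have "keys (f + g) \<subseteq> keys f \<union> keys g" by (rule Poly_Mapping.keys_add)
  then show ?thesis
    by (simp add: pairing_superset[of "keys f \<union> keys g"] lookup_add ring_distribs sum.distrib)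
qed

lemma pairing_sum: "pairing \<phi> (\<Sum>i\<in>I. f i) = (\<Sum>i\<in>I. pairing \<phi> (f i))"
  by (induction I rule: infinite_finite_induct) (auto simp: pairing_add)

lemma pairing_single: "pairing \<phi> (single a c) = c * \<phi> a"
  by (simp add: pairing_def)

lemma lookup_eq_pairing: "lookup f c = pairing (\<lambda>a. of_bool (a = c)) f"
proof -
  have "pairing (\<lambda>a. of_bool (a = c)) f = (\<Sum>a\<in>insert c (keys f). lookup f a * of_bool (a = c))"
    by (rule pairing_superset) auto
  also have "\<dots> = lookup f c"
    by (subst sum.remove[of _ c]) (auto intro!: sum.neutral)
  finally show ?thesis by simp
qed

lemma sum_single: "(\<Sum>a\<in>keys f. single a (lookup f a)) = f"
  by (rule poly_mapping_eqI)
     (auto simp: lookup_sum lookup_single when_def in_keys_iff)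

lemma mult_eq_sum_single:
  fixes f g :: "'a::comm_monoid_add \<Rightarrow>\<^sub>0 real"
  shows "f * g = (\<Sum>a\<in>keys f. \<Sum>b\<in>keys g. single (a + b) (lookup f a * lookup g b))"
proof -
  have "f * g = (\<Sum>a\<in>keys f. single a (lookup f a)) * (\<Sum>b\<in>keys g. single b (lookup g b))"
    by (simp add: sum_single)
  then show ?thesis by (simp add: sum_product mult_single)
qed

lemma pairing_mult:
  fixes f g :: "'a::comm_monoid_add \<Rightarrow>\<^sub>0 real"
  shows "pairing \<phi> (f * g) = (\<Sum>a\<in>keys f. \<Sum>b\<in>keys g. lookup f a * lookup g b * \<phi> (a + b))"
  by (subst mult_eq_sum_single) (simp add: pairing_sum pairing_single)

lemma lookup_mult_diff:
  fixes f g :: "'a::ab_group_add \<Rightarrow>\<^sub>0 real"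
  shows "lookup (f * g) c = (\<Sum>a\<in>keys f. lookup f a * lookup g (c - a))"
proof -
  have "(\<Sum>b\<in>keys g. lookup f a * lookup g b * of_bool (a + b = c)) = lookup f a * lookup g (c - a)" for a
  proof -
    have "(\<Sum>b\<in>keys g. lookup f a * lookup g b * of_bool (a + b = c))
        = lookup f a * pairing (\<lambda>b. of_bool (b = c - a)) g"
      unfolding pairing_def sum_distrib_left
      by (rule sum.cong) (auto simp: algebra_simps)
    then show ?thesis by (simp flip: lookup_eq_pairing)
  qed
  then show ?thesis by (simp add: lookup_eq_pairing[of "f * g"] pairing_mult)
qed

section \<open>Leading exponents\<close>

definition lin :: "int \<times> int \<Rightarrow> int \<times> int \<Rightarrow> int" where
  "lin u a = fst u * fst a + snd u * snd a"

lemma lin_add: "lin u (a + b) = lin u a + lin u b"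
  by (simp add: lin_def algebra_simps)

text \<open>Ties in the direction \<open>u\<close> are broken by the orthogonal direction.\<close>

definition is_lead :: "int \<times> int \<Rightarrow> (int \<times> int) set \<Rightarrow> int \<times> int \<Rightarrow> bool" where
  "is_lead u A a \<longleftrightarrow> a \<in> A \<and>
    (\<forall>b\<in>A. lin u b < lin u a \<or> lin u b = lin u a \<and> lin (- snd u, fst u) b \<le> lin (- snd u, fst u) a)"

lemma is_lead_exists:
  assumes "finite A" "A \<noteq> {}"
  shows "\<exists>a. is_lead u A a"
proof -
  define M where "M = Max (lin u ` A)"
  define A' where "A' = {a\<in>A. lin u a = M}"
  have M: "M \<in> lin u ` A" unfolding M_def using assms by (intro Max_in) auto
  then have A': "finite A'" "A' \<noteq> {}" using assms by (auto simp: A'_def)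
  define M' where "M' = Max (lin (- snd u, fst u) ` A')"
  have "M' \<in> lin (- snd u, fst u) ` A'" unfolding M'_def using A' by (intro Max_in) auto
  then obtain a where a: "a \<in> A'" "lin (- snd u, fst u) a = M'" by auto
  have "is_lead u A a" unfolding is_lead_def
  proof (intro conjI ballI)
    show "a \<in> A" using a by (auto simp: A'_def)
    fix b assume b: "b \<in> A"
    then have "lin u b \<le> M" unfolding M_def using assms by (intro Max_ge) auto
    moreover have "lin u a = M" using a by (auto simp: A'_def)
    moreover have "lin (- snd u, fst u) b \<le> M'" if "lin u b = M"
      unfolding M'_def using that b A' by (intro Max_ge) (auto simp: A'_def)
    ultimately show "lin u b < lin u a \<or> lin u b = lin u a \<and> lin (- snd u, fst u) b \<le> lin (- snd u, fst u) a"
      using a by auto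
  qed
  then show ?thesis ..
qed

text \<open>The vector \<open>u = (p, q)\<close> and its quarter turn form a matrix with determinant
  \<open>p * p + q * q\<close>, which is nonzero for \<open>u \<noteq> 0\<close>.\<close>

lemma lin_inject:
  assumes "u \<noteq> 0" "lin u a = lin u b" "lin (- snd u, fst u) a = lin (- snd u, fst u) b"
  shows "a = b"
proof -
  obtain p q a1 a2 b1 b2 where eq: "u = (p, q)" "a = (a1, a2)" "b = (b1, b2)"
    by (metis prod.collapse)
  have 1: "p * (a1 - b1) + q * (a2 - b2) = 0" and 2: "p * (a2 - b2) - q * (a1 - b1) = 0"
    using assms by (auto simp: eq lin_def algebra_simps)
  have "(p * p + q * q) * (a1 - b1) = p * (p * (a1 - b1) + q * (a2 - b2)) - q * (p * (a2 - b2) - q * (a1 - b1))"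
    by (simp add: algebra_simps)
  moreover have "(p * p + q * q) * (a2 - b2) = q * (p * (a1 - b1) + q * (a2 - b2)) + p * (p * (a2 - b2) - q * (a1 - b1))"
    by (simp add: algebra_simps)
  moreover have "p * p + q * q \<noteq> 0"
    using assms(1) by (auto simp: eq zero_prod_def sum_squares_eq_zero_iff)
  ultimately show ?thesis using 1 2 by (auto simp: eq)
qed

text \<open>\<open>is_lead\<close> selects the maximum of a total order compatible with addition. In
  another decomposition of \<open>a + b\<close> into exponents of \<open>f\<close> and
  \<open>g\<close>, a smaller part would force the other to exceed the maximum, so only one term
  contributes.\<close>

lemma lookup_mult_lead:
  fixes f g :: FZ2
  assumes "u \<noteq> 0" "is_lead u (keys f) a" "is_lead u (keys g) b"
  shows "lookup (f * g) (a + b) = lookup f a * lookup g b"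
proof -
  have "lookup f a' * lookup g (a + b - a') = 0" if "a' \<in> keys f" "a' \<noteq> a" for a'
  proof (rule ccontr)
    assume "\<not> ?thesis"
    then have "a + b - a' \<in> keys g" by (auto simp: in_keys_iff)
    moreover define b' where "b' = a + b - a'"
    ultimately have b': "b' \<in> keys g" "a + b = a' + b'" by auto
    have "lin v a + lin v b = lin v a' + lin v b'" for v
      using b'(2) by (metis lin_add)
    from this[of u] this[of "(- snd u, fst u)"]
    have "lin u a = lin u a'" "lin (- snd u, fst u) a = lin (- snd u, fst u) a'"
      using assms(2,3) that(1) b'(1) unfolding is_lead_def by force+
    with lin_inject[OF assms(1)] that show False by metis
  qed
  moreover have "a \<in> keys f" using assms(2) by (simp add: is_lead_def)
  ultimately show ?thesis
    unfolding lookup_mult_diff by (subst sum.remove[of _ a]) (simp_all add: sum.neutral)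
qed

lemma is_lead_exists_keys:
  fixes f :: FZ2
  assumes "f \<noteq> 0"
  shows "\<exists>a. is_lead u (keys f) a"
  using is_lead_exists[of "keys f"] assms by simp

lemma is_lead_keysD: "is_lead u (keys f) a \<Longrightarrow> lookup f a \<noteq> 0"
  by (simp add: is_lead_def in_keys_iff)

lemma FZ2_mult_eq_0_iff:
  fixes f g :: FZ2
  shows "f * g = 0 \<longleftrightarrow> f = 0 \<or> g = 0"
proof
  assume *: "f * g = 0"
  show "f = 0 \<or> g = 0"
  proof (rule ccontr)
    assume "\<not> ?thesis"
    then obtain a b where "is_lead (1,0) (keys f) a" "is_lead (1,0) (keys g) b"
      using is_lead_exists_keys by metis
    then show False
      using lookup_mult_lead[of "(1,0)" f a g b] * is_lead_keysD[of "(1,0)" f a] is_lead_keysD[of "(1,0)" g b]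
      by (simp add: zero_prod_def)
  qed
qed auto

lemma FZ2_mult_left_cancel:
  fixes f g h :: FZ2
  assumes "f \<noteq> 0"
  shows "f * g = f * h \<longleftrightarrow> g = h"
  using FZ2_mult_eq_0_iff[of f "g - h"] assms by (auto simp: algebra_simps)

lemma FZ2_power_eq_0_iff:
  fixes f :: FZ2
  assumes "f \<noteq> 0"
  shows "f ^ k \<noteq> 0"
  using assms by (induction k) (auto simp: FZ2_mult_eq_0_iff)

definition support_max :: "int \<times> int \<Rightarrow> FZ2 \<Rightarrow> int" where
  "support_max u f = Max (lin u ` keys f)"

lemma support_max_ge: "a \<in> keys f \<Longrightarrow> lin u a \<le> support_max u f"
  unfolding support_max_def by (intro Max_ge) auto

lemma support_max_le: "f \<noteq> 0 \<Longrightarrow> (\<And>a. a \<in> keys f \<Longrightarrow> lin u a \<le> c) \<Longrightarrow> support_max u f \<le> c"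
  unfolding support_max_def by (subst Max_le_iff) auto

lemma is_lead_support_max: "is_lead u (keys f) a \<Longrightarrow> lin u a = support_max u f"
  unfolding support_max_def is_lead_def by (intro Max_eqI[symmetric]) force+

text \<open>The product of the two leading terms cannot cancel, so the sum of the maxima is
  attained. This is the additivity of support functions behind
  \<open>NP(f g) = NP(f) + NP(g)\<close>.\<close>

lemma support_max_mult:
  assumes "f \<noteq> 0" "g \<noteq> 0" "u \<noteq> 0"
  shows "support_max u (f * g) = support_max u f + support_max u g"
proof (rule antisym)
  have fg: "f * g \<noteq> 0" using assms by (simp add: FZ2_mult_eq_0_iff)
  show "support_max u (f * g) \<le> support_max u f + support_max u g"
  proof (rule support_max_le[OF fg])
    fix c assume "c \<in> keys (f * g)"
    then obtain a b where "c = a + b" "a \<in> keys f" "b \<in> keys g"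
      using Poly_Mapping.keys_mult[of f g] by auto
    then show "lin u c \<le> support_max u f + support_max u g"
      by (auto simp: lin_add intro!: add_mono support_max_ge)
  qed
  obtain a b where ab: "is_lead u (keys f) a" "is_lead u (keys g) b"
    using is_lead_exists_keys assms by metis
  then have "lookup (f * g) (a + b) \<noteq> 0"
    using lookup_mult_lead[OF assms(3) ab] ab[THEN is_lead_keysD] by simp
  then have "lin u (a + b) \<le> support_max u (f * g)"
    by (intro support_max_ge) (simp add: in_keys_iff)
  then show "support_max u f + support_max u g \<le> support_max u (f * g)"
    using ab by (simp add: lin_add is_lead_support_max)
qed

lemma support_max_power:
  assumes "f \<noteq> 0" "u \<noteq> 0"
  shows "support_max u (f ^ k) = int k * support_max u f"
proof (induction k)
  case 0
  then show ?case by (simp add: support_max_def lin_def)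
next
  case (Suc k)
  then show ?case using assms by (simp add: support_max_mult FZ2_power_eq_0_iff algebra_simps)
qed

section \<open>Order of vanishing\<close>

definition mon :: "nat \<times> nat \<Rightarrow> int \<times> int \<Rightarrow> real" where
  "mon e a = real_of_int (fst a) ^ fst e * real_of_int (snd a) ^ snd e"

lemma moment_eq_pairing: "moment f e = pairing (mon e) f"
  by (simp add: moment_def pairing_def mon_def)

text \<open>Monomials of degree below \<open>n\<close> span the same weights as the falling
  factorials produced by partial derivatives at (1, 1), so this is vanishing to order
  \<open>n\<close> at that point.\<close>

definition vanishes :: "nat \<Rightarrow> FZ2 \<Rightarrow> bool" where
  "vanishes n f \<longleftrightarrow> (\<forall>e. exp_deg e < n \<longrightarrow> moment f e = 0)"

lemma vanishes_add: "vanishes n f \<Longrightarrow> vanishes n g \<Longrightarrow> vanishes n (f + g)"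
  by (simp add: vanishes_def moment_eq_pairing pairing_add)

lemma mon_add:
  "mon (p, q) (a + b) = (\<Sum>i\<le>p. \<Sum>j\<le>q. of_nat (p choose i) * of_nat (q choose j) * mon (i, j) a * mon (p - i, q - j) b)"
  unfolding mon_def by (simp add: binomial_ring sum_product mult_ac)

text \<open>The binomial expansion of a monomial at \<open>a + b\<close> acts as a Leibniz rule:
  each term is a multiple of a moment of \<open>f\<close> times a moment of \<open>g\<close>. Their
  orders add up to less than \<open>m + n\<close>, so one of the two moments is zero.\<close>

lemma vanishes_mult:
  assumes "vanishes m f" "vanishes n g"
  shows "vanishes (m + n) (f * g)"
  unfolding vanishes_def
proof (intro allI impI)
  fix e :: "nat \<times> nat" assume e: "exp_deg e < m + n"
  obtain p q where pq: "e = (p, q)" by (cases e)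
  have "moment (f * g) e = (\<Sum>a\<in>keys f. \<Sum>b\<in>keys g. \<Sum>i\<le>p. \<Sum>j\<le>q.
      (of_nat (p choose i) * of_nat (q choose j)) * ((lookup f a * mon (i, j) a) * (lookup g b * mon (p - i, q - j) b)))"
    unfolding moment_eq_pairing pq pairing_mult mon_add
    by (simp add: sum_distrib_left mult_ac)
  also have "\<dots> = (\<Sum>i\<le>p. \<Sum>j\<le>q. \<Sum>a\<in>keys f. \<Sum>b\<in>keys g.
      (of_nat (p choose i) * of_nat (q choose j)) * ((lookup f a * mon (i, j) a) * (lookup g b * mon (p - i, q - j) b)))"
    (is "?l = _")
  proof -
    have "?l = (\<Sum>a\<in>keys f. \<Sum>i\<le>p. \<Sum>b\<in>keys g. \<Sum>j\<le>q.
      (of_nat (p choose i) * of_nat (q choose j)) * ((lookup f a * mon (i, j) a) * (lookup g b * mon (p - i, q - j) b)))"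
      by (rule sum.cong[OF refl], rule sum.swap)
    also have "\<dots> = (\<Sum>i\<le>p. \<Sum>a\<in>keys f. \<Sum>j\<le>q. \<Sum>b\<in>keys g.
      (of_nat (p choose i) * of_nat (q choose j)) * ((lookup f a * mon (i, j) a) * (lookup g b * mon (p - i, q - j) b)))"
      by (subst sum.swap, (rule sum.cong[OF refl])+, rule sum.swap)
    also have "\<dots> = (\<Sum>i\<le>p. \<Sum>j\<le>q. \<Sum>a\<in>keys f. \<Sum>b\<in>keys g.
      (of_nat (p choose i) * of_nat (q choose j)) * ((lookup f a * mon (i, j) a) * (lookup g b * mon (p - i, q - j) b)))"
      by (rule sum.cong[OF refl], rule sum.swap)
    finally show ?thesis .
  qed
  also have "\<dots> = (\<Sum>i\<le>p. \<Sum>j\<le>q. of_nat (p choose i) * of_nat (q choose j)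
      * (moment f (i, j) * moment g (p - i, q - j)))"
    unfolding moment_eq_pairing pairing_def sum_product by (simp add: sum_distrib_left)
  also have "\<dots> = 0"
  proof (intro sum.neutral ballI)
    fix i j assume ij: "i \<in> {..p}" "j \<in> {..q}"
    then have "i + j < m \<or> (p - i) + (q - j) < n" using e by (auto simp: exp_deg_def pq)
    then have "moment f (i, j) = 0 \<or> moment g (p - i, q - j) = 0"
      using assms by (auto simp: vanishes_def exp_deg_def)
    then show "of_nat (p choose i) * of_nat (q choose j) * (moment f (i, j) * moment g (p - i, q - j)) = 0"
      by auto
  qed
  finally show "moment (f * g) e = 0" .
qed

lemma vanishes_power: "vanishes m f \<Longrightarrow> vanishes (k * m) (f ^ k)"
  by (induction k) (auto simp: vanishes_mult, simp add: vanishes_def)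

section \<open>Interpolation on lattice triangles\<close>

definition affine_form :: "real \<times> real \<times> real \<Rightarrow> int \<times> int \<Rightarrow> real" where
  "affine_form l a = fst l * real_of_int (fst a) + fst (snd l) * real_of_int (snd a) + snd (snd l)"

text \<open>An affine form raises the degree of a monomial by at most one, so each factor costs one
  order of vanishing. The weight \<open>\<phi>\<close> is arbitrary so that the induction can absorb
  the factors one by one.\<close>

lemma vanishes_affine_forms:
  assumes "\<And>e. exp_deg e < n + length ls \<Longrightarrow> pairing (\<lambda>a. mon e a * \<phi> a) f = 0" "exp_deg e < n"
  shows "pairing (\<lambda>a. mon e a * (prod_list (map (\<lambda>l. affine_form l a) ls) * \<phi> a)) f = 0"
  using assms
proof (induction ls arbitrary: \<phi> e)
  case Nil
  then show ?case by simp
next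
  case (Cons l ls)
  have "pairing (\<lambda>a. mon e a * (affine_form l a * \<phi> a)) f = 0" if "exp_deg e < n + length ls" for e
  proof -
    have *: "pairing (\<lambda>a. mon e a * \<phi> a) f = 0" "pairing (\<lambda>a. mon (Suc (fst e), snd e) a * \<phi> a) f = 0"
       "pairing (\<lambda>a. mon (fst e, Suc (snd e)) a * \<phi> a) f = 0"
      using that by (auto intro!: Cons.prems(1) simp: exp_deg_def)
    have "pairing (\<lambda>a. mon e a * (affine_form l a * \<phi> a)) f
      = fst l * pairing (\<lambda>a. mon (Suc (fst e), snd e) a * \<phi> a) f
      + fst (snd l) * pairing (\<lambda>a. mon (fst e, Suc (snd e)) a * \<phi> a) f
      + snd (snd l) * pairing (\<lambda>a. mon e a * \<phi> a) f"
      unfolding pairing_def sum_distrib_left sum.distrib[symmetric]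
      by (rule sum.cong) (auto simp: affine_form_def mon_def algebra_simps)
    then show ?thesis using * by simp
  qed
  from Cons.IH[of "\<lambda>a. affine_form l a * \<phi> a", OF this] Cons.prems(2)
  show ?case by (simp add: mult_ac)
qed

lemma vanishes_prod_affine_forms:
  assumes "vanishes n f" "length ls < n"
  shows "pairing (\<lambda>a. prod_list (map (\<lambda>l. affine_form l a) ls)) f = 0"
proof -
  have "pairing (\<lambda>a. mon (0, 0) a * (prod_list (map (\<lambda>l. affine_form l a) ls) * 1)) f = 0"
    \<comment> \<open>The instance \<open>n = 1\<close> leaves only the exponent
      \<open>(0, 0)\<close>, and \<open>1 + length ls\<close> does not exceed the order of vanishing
      of \<open>f\<close>.\<close>
    by (rule vanishes_affine_forms[where n = 1])
       (use assms in \<open>auto simp: exp_deg_def vanishes_def moment_eq_pairing\<close>)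
  then show ?thesis by (simp add: mon_def)
qed

text \<open>It has as many points as there are exponents of degree below \<open>n\<close>, so a
  function supported on it has as many coefficients as there are moment conditions of order below
  \<open>n\<close>.\<close>

definition triangle :: "int \<times> int \<Rightarrow> nat \<Rightarrow> (int \<times> int) set" where
  "triangle b n = (\<lambda>(i, j). (fst b + int i, snd b + int j)) ` {(i, j). i + j < n}"

text \<open>A point of the support with maximal coordinate sum is isolated from the rest of the
  support by fewer than \<open>n\<close> horizontal and vertical lines.\<close>

lemma vanishes_triangle:
  assumes "vanishes n f" "keys f \<subseteq> triangle b n"
  shows "f = 0"
proof (rule ccontr)
  assume "f \<noteq> 0"
  define h where "h = (\<lambda>a::int \<times> int. fst a + snd a)"
  have "finite (keys f)" "keys f \<noteq> {}" using \<open>f \<noteq> 0\<close> by auto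
  from ex_is_arg_min_if_finite[OF this, of "\<lambda>a. - h a"]
  obtain a where a: "a \<in> keys f" "\<And>c. c \<in> keys f \<Longrightarrow> h c \<le> h a"
    unfolding is_arg_min_def by fastforce
  obtain i j where ij: "a = (fst b + int i, snd b + int j)" "i + j < n"
    using a(1) assms(2) by (auto simp: triangle_def)
  \<comment> \<open>The \<open>i\<close> vertical lines left of \<open>a\<close> and the
    \<open>j\<close> horizontal lines below it, inside the triangle. Any other support point has no
    larger coordinate sum, hence lies on one of them.\<close>
  define ls :: "(real \<times> real \<times> real) list" where
    "ls = map (\<lambda>l. (1, 0, - of_int (fst b + int l))) [0..<i] @ map (\<lambda>l. (0, 1, - of_int (snd b + int l))) [0..<j]"
  define p where "p = (\<lambda>a. prod_list (map (\<lambda>l. affine_form l a) ls))"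
  have "p c = 0" if c: "c \<in> keys f" "c \<noteq> a" for c
  proof -
    obtain i' j' where c': "c = (fst b + int i', snd b + int j')"
      using c(1) assms(2) by (auto simp: triangle_def)
    have "i' + j' \<le> i + j" using a(2)[OF c(1)] by (simp add: h_def ij(1) c')
    moreover have "(i', j') \<noteq> (i, j)" using c(2) ij(1) c' by auto
    ultimately have "i' < i \<or> j' < j" by (auto simp: not_less)
    then show ?thesis
      unfolding p_def prod_list_zero_iff ls_def by (force simp: affine_form_def c')
  qed
  then have "pairing p f = lookup f a * p a"
    unfolding pairing_def using a(1) by (subst sum.remove[of _ a]) (auto intro!: sum.neutral)
  moreover have "p a \<noteq> 0"
    unfolding p_def prod_list_zero_iff by (auto simp: affine_form_def ls_def ij(1))
  moreover have "lookup f a \<noteq> 0" using a(1) by (simp add: in_keys_iff)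
  moreover have "pairing p f = 0"
    unfolding p_def using assms(1) by (rule vanishes_prod_affine_forms) (use ij in \<open>simp add: ls_def\<close>)
  ultimately show False by simp
qed

lemma finite_subset_triangle:
  assumes "finite A"
  shows "\<exists>b n. A \<subseteq> triangle b n"
proof -
  define M where "M = Max ((\<lambda>a. \<bar>fst a\<bar> + \<bar>snd a\<bar>) ` A)"
  have M: "\<bar>fst a\<bar> + \<bar>snd a\<bar> \<le> M" if "a \<in> A" for a
    unfolding M_def using assms that by (intro Max_ge) auto
  \<comment> \<open>Shifting by \<open>M\<close> makes both coordinates nonnegative, and their sum
    is then at most \<open>M + 2 * M\<close>.\<close>
  have "a \<in> triangle (-M, -M) (nat (3 * M) + 1)" if "a \<in> A" for a
    unfolding triangle_def using M[OF that]
    by (intro image_eqI[of _ _ "(nat (fst a + M), nat (snd a + M))"]) auto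
  then show ?thesis by blast
qed

text \<open>The minimum in \<open>sm\<close> exists: some moment is nonzero, since otherwise
  \<open>f\<close> would vanish to every order while supported on some triangle, and the monomial
  order is well-founded and total. Below the degree of a minimum all moments are zero.\<close>

lemma vanishes_sm:
  assumes "f \<noteq> 0"
  shows "vanishes (exp_deg (sm f)) f"
proof -
  have "\<exists>e. moment f e \<noteq> 0"
  proof (rule ccontr)
    assume "\<not> ?thesis"
    then have "vanishes n f" for n by (simp add: vanishes_def)
    then show False using vanishes_triangle finite_subset_triangle[of "keys f"] assms by auto
  qed
  moreover define r where "r = inv_image (less_than <*lex*> less_than) (\<lambda>e. (exp_deg e, snd e))"
  have "wf r" by (auto simp: r_def)
  ultimately obtain e where e: "moment f e \<noteq> 0" "\<And>e'. (e', e) \<in> r \<Longrightarrow> moment f e' = 0"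
    using wf_eq_minimal[THEN iffD1, rule_format, of r _ "{e. moment f e \<noteq> 0}"] by blast
  have *: "e = e' \<or> monom_less e e'" if "moment f e' \<noteq> 0" for e'
  proof -
    have "(e', e) \<notin> r" using e(2)[of e'] that by blast
    then show ?thesis
      unfolding r_def monom_less_def exp_deg_def prod_eq_iff in_inv_image in_lex_prod less_than_iff
      by auto
  qed
  have "sm f = e" unfolding sm_def
  proof (rule the_equality)
    fix d assume d: "moment f d \<noteq> 0 \<and> (\<forall>e'. moment f e' \<noteq> 0 \<longrightarrow> d = e' \<or> monom_less d e')"
    then have "d = e \<or> monom_less d e" using e(1) by blast
    moreover have "e = d \<or> monom_less e d" using d * by blast
    ultimately show "d = e" unfolding monom_less_def by (elim disjE conjE) simp_all
  qed (use e(1) * in auto)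
  moreover have "moment f e' = 0" if "exp_deg e' < exp_deg e" for e'
    using *[of e'] that by (auto simp: monom_less_def)
  ultimately show ?thesis by (simp add: vanishes_def)
qed

section \<open>Counting dimensions\<close>

text \<open>Gaussian elimination: an equation with nonzero coefficient at \<open>p\<close> is
  subtracted from the others to remove the unknown \<open>p\<close>, whose value \<open>t\<close> is
  recovered from that equation at the end.\<close>

lemma homogeneous_system:
  fixes c :: "'e \<Rightarrow> 'i \<Rightarrow> real"
  assumes "finite E" "finite I" "card E < card I"
  shows "\<exists>x. (\<exists>i\<in>I. x i \<noteq> 0) \<and> (\<forall>e\<in>E. (\<Sum>i\<in>I. c e i * x i) = 0)"
  using assms
proof (induction E arbitrary: I c rule: finite_induct)
  case empty
  then obtain i where "i \<in> I" by fastforce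
  then show ?case by (intro exI[of _ "\<lambda>_. 1"]) auto
next
  case (insert e E)
  show ?case
  proof (cases "\<forall>i\<in>I. c e i = 0")
    case True
    have "card E < card I" using insert by simp
    from insert.IH[OF insert.prems(1) this, of c] obtain x where
      "\<exists>i\<in>I. x i \<noteq> 0" "\<forall>e\<in>E. (\<Sum>i\<in>I. c e i * x i) = 0" by blast
    then show ?thesis using True by (intro exI[of _ x]) auto
  next
    case False
    then obtain p where p: "p \<in> I" "c e p \<noteq> 0" by blast
    define d where "d = (\<lambda>e' i. c e' i - c e' p / c e p * c e i)"
    have "card E < card (I - {p})" using insert p by simp
    from insert.IH[OF finite_Diff[OF insert.prems(1)] this, of d] obtain x where
      x: "\<exists>i\<in>I - {p}. x i \<noteq> 0" "\<And>e'. e' \<in> E \<Longrightarrow> (\<Sum>i\<in>I - {p}. d e' i * x i) = 0" by blast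
    define t where "t = - (\<Sum>i\<in>I - {p}. c e i * x i) / c e p"
    define y where "y = x(p := t)"
    have y: "(\<Sum>i\<in>I. c e' i * y i) = c e' p * t + (\<Sum>i\<in>I - {p}. c e' i * x i)" for e'
    proof -
      have "(\<Sum>i\<in>I. c e' i * y i) = c e' p * y p + (\<Sum>i\<in>I - {p}. c e' i * y i)"
        using insert.prems(1) p(1) by (rule sum.remove)
      also have "(\<Sum>i\<in>I - {p}. c e' i * y i) = (\<Sum>i\<in>I - {p}. c e' i * x i)"
        by (rule sum.cong) (auto simp: y_def)
      finally show ?thesis by (simp add: y_def)
    qed
    have "(\<Sum>i\<in>I. c e' i * y i) = 0" if "e' \<in> insert e E" for e'
    proof (cases "e' = e")
      case True
      then show ?thesis using p(2) by (simp add: y t_def)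
    next
      case False
      then have "0 = (\<Sum>i\<in>I - {p}. d e' i * x i)" using x(2) that by simp
      also have "\<dots> = (\<Sum>i\<in>I - {p}. c e' i * x i) - c e' p / c e p * (\<Sum>i\<in>I - {p}. c e i * x i)"
        unfolding d_def sum_distrib_left sum_subtractf[symmetric]
        by (rule sum.cong) (simp_all add: left_diff_distrib)
      finally show ?thesis by (simp add: y t_def)
    qed
    moreover have "\<exists>i\<in>I. y i \<noteq> 0" using x(1) by (auto simp: y_def)
    ultimately show ?thesis by blast
  qed
qed

text \<open>Asking only for the existence of coefficients allows linearity to be derived by closure
  rules, without writing down the matrix of the system.\<close>

definition linear_form_on :: "'i set \<Rightarrow> (('i \<Rightarrow> real) \<Rightarrow> real) \<Rightarrow> bool" where
  "linear_form_on I L \<longleftrightarrow> (\<exists>c. \<forall>x. L x = (\<Sum>i\<in>I. c i * x i))"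

lemma linear_form_on_coord:
  assumes "finite I"
  shows "linear_form_on I (\<lambda>x. x i when i \<in> I)"
proof -
  have "(x i when i \<in> I) = (\<Sum>j\<in>I. of_bool (j = i) * x j)" for x :: "'a \<Rightarrow> real"
    using assms by (cases "i \<in> I") (auto simp: sum.remove[of I i] intro!: sum.neutral)
  then show ?thesis unfolding linear_form_on_def by (intro exI[of _ "\<lambda>j. of_bool (j = i)"]) simp
qed

lemma linear_form_on_scale: "linear_form_on I L \<Longrightarrow> linear_form_on I (\<lambda>x. r * L x)"
  unfolding linear_form_on_def
proof (elim exE)
  fix c assume "\<forall>x. L x = (\<Sum>i\<in>I. c i * x i)"
  then show "\<exists>c. \<forall>x. r * L x = (\<Sum>i\<in>I. c i * x i)"
    by (intro exI[of _ "\<lambda>i. r * c i"]) (simp add: sum_distrib_left mult.assoc)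
qed

lemma linear_form_on_0: "linear_form_on I (\<lambda>x. 0)"
  unfolding linear_form_on_def by (intro exI[of _ "\<lambda>_. 0"]) simp

lemma linear_form_on_add:
  "linear_form_on I L \<Longrightarrow> linear_form_on I M \<Longrightarrow> linear_form_on I (\<lambda>x. L x + M x)"
  unfolding linear_form_on_def
proof (elim exE)
  fix c d assume "\<forall>x. L x = (\<Sum>i\<in>I. c i * x i)" "\<forall>x. M x = (\<Sum>i\<in>I. d i * x i)"
  then show "\<exists>c. \<forall>x. L x + M x = (\<Sum>i\<in>I. c i * x i)"
    by (intro exI[of _ "\<lambda>i. c i + d i"]) (simp add: sum.distrib ring_distribs)
qed

lemma linear_form_on_sum:
  "(\<And>j. j \<in> J \<Longrightarrow> linear_form_on I (L j)) \<Longrightarrow> linear_form_on I (\<lambda>x. \<Sum>j\<in>J. L j x)"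
  by (induction J rule: infinite_finite_induct) (auto intro: linear_form_on_0 linear_form_on_add)

lemma linear_forms_common_zero:
  assumes "finite E" "finite I" "card E < card I" "\<And>e. e \<in> E \<Longrightarrow> linear_form_on I (L e)"
  shows "\<exists>x. (\<exists>i\<in>I. x i \<noteq> 0) \<and> (\<forall>e\<in>E. L e x = 0)"
proof -
  obtain c where "\<And>e x. e \<in> E \<Longrightarrow> L e x = (\<Sum>i\<in>I. c e i * x i)"
    using assms(4) unfolding linear_form_on_def by metis
  then show ?thesis using homogeneous_system[OF assms(1-3), of c] by auto
qed

lemma card_triangle_exponents: "2 * card {e. exp_deg e < n} = n * (n + 1)"
  and finite_triangle_exponents: "finite {e. exp_deg e < n}"
proof -
  have *: "{e. exp_deg e < n} = (SIGMA i:{..<n}. {..<n - i})"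
    by (auto simp: exp_deg_def)
  show "finite {e. exp_deg e < n}" unfolding * by auto
  have "(\<Sum>i<n. n - i) * 2 = n * (n + 1)"
    using gauss_sum_from_Suc_0[of n, where ?'a = nat]
    by (subst sum.nat_diff_reindex[symmetric]) (auto simp: sum.atLeast1_atMost_eq Suc_diff_Suc)
  then show "2 * card {e. exp_deg e < n} = n * (n + 1)"
    unfolding * by (simp add: mult.commute)
qed

lemma triangle_eq: "triangle b n = (\<lambda>(i, j). (fst b + int i, snd b + int j)) ` {e. exp_deg e < n}"
  by (simp add: triangle_def exp_deg_def case_prod_unfold)

lemma finite_triangle: "finite (triangle b n)"
  by (simp add: triangle_eq finite_triangle_exponents)

lemma card_triangle: "card (triangle b n) = card {e. exp_deg e < n}"
  unfolding triangle_eq by (rule card_image) (auto simp: inj_on_def)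

definition restrict_poly_mapping :: "'a set \<Rightarrow> ('a \<Rightarrow> real) \<Rightarrow> 'a \<Rightarrow>\<^sub>0 real" where
  "restrict_poly_mapping A x = (\<Sum>a\<in>A. single a (x a))"

lemma lookup_restrict_poly_mapping:
  "finite A \<Longrightarrow> lookup (restrict_poly_mapping A x) a = (x a when a \<in> A)"
  by (auto simp: restrict_poly_mapping_def lookup_sum lookup_single when_def)

lemma keys_restrict_poly_mapping: "finite A \<Longrightarrow> keys (restrict_poly_mapping A x) \<subseteq> A"
  by (auto simp: in_keys_iff lookup_restrict_poly_mapping when_def split: if_splits)

lemma keys_mult_subset:
  "(\<And>a b. a \<in> keys f \<Longrightarrow> b \<in> keys g \<Longrightarrow> a + b \<in> K) \<Longrightarrow> keys (f * g) \<subseteq> K"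
  using Poly_Mapping.keys_mult[of f g] by blast

lemma sum3_cases:
  obtains (1) a where "x = Inl a" | (2) b where "x = Inr (Inl b)" | (3) c where "x = Inr (Inr (Inl c))"
    | (4) d where "x = Inr (Inr (Inr d))"
proof (cases x)
  case (Inr y)
  then show ?thesis
  proof (cases y)
    case Inr': (Inr z)
    then show ?thesis using Inr that(3,4) by (cases z) auto
  qed (use Inr that(2) in auto)
qed (use that(1) in auto)

text \<open>Otherwise a homogeneous linear system has a nonzero solution \<open>(g\<^sub>1, g\<^sub>2, s)\<close> with \<open>s\<close> supported on
  the triangle, \<open>F\<^sub>1 g\<^sub>1 + F\<^sub>2 g\<^sub>2 + s = 0\<close> on \<open>K\<close> and the low moments of \<open>g\<^sub>1\<close>, \<open>g\<^sub>2\<close> zero, which forces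
  \<open>s = 0\<close>. The \<open>card R\<close> equations \<open>g\<^sub>1 (r + b) = 0\<close>, with \<open>b\<close> the leading exponent of \<open>F\<^sub>2\<close>, exclude
  the syzygies \<open>g\<^sub>1 = F\<^sub>2 h\<close>.\<close>

lemma ideal_dimension_count:
  fixes F1 F2 :: FZ2
  assumes F: "F1 \<noteq> 0" "F2 \<noteq> 0"
    and syzygy: "\<And>g. F2 dvd F1 * g \<Longrightarrow> F2 dvd g"
    and van: "vanishes n1 F1" "vanishes n2 F2"
    and fin: "finite K" "finite K1" "finite K2" "finite R"
    and K1: "\<And>a b. a \<in> keys F1 \<Longrightarrow> b \<in> K1 \<Longrightarrow> a + b \<in> K"
    and K2: "\<And>a b. a \<in> keys F2 \<Longrightarrow> b \<in> K2 \<Longrightarrow> a + b \<in> K"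
    and R: "\<And>h. h \<noteq> 0 \<Longrightarrow> keys (F2 * h) \<subseteq> K1 \<Longrightarrow> keys h \<subseteq> R"
    and T: "triangle t (n1 + n2) \<subseteq> K"
  shows "card K1 + card K2 + n1 * n2 \<le> card K + card R"
proof (rule ccontr)
  assume less: "\<not> ?thesis"
  define T where "T = triangle t (n1 + n2)"
  have finT: "finite T" by (simp add: T_def finite_triangle)
  define D where "D n = {e. exp_deg e < n}" for n
  have finD: "finite (D n)" for n by (simp add: D_def finite_triangle_exponents)
  have card_D: "2 * card (D n) = n * (n + 1)" for n
    by (simp only: D_def card_triangle_exponents)
  \<comment> \<open>The cross term of triangular numbers: the triangle supplies
    \<open>n1 * n2\<close> more unknowns than there are moment conditions on \<open>g1\<close> and
    \<open>g2\<close>. This surplus is the source of the product in the bound.\<close>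
  have "card T = card (D n1) + card (D n2) + n1 * n2"
    using card_D[of n1] card_D[of n2] card_D[of "n1 + n2"] card_triangle[of t "n1 + n2"]
    unfolding T_def D_def[symmetric] by (simp add: algebra_simps)
  \<comment> \<open>The unknowns are the coefficients of \<open>g1\<close>, \<open>g2\<close> and
    \<open>s\<close>. The equations are, in this order, the coefficients on \<open>K\<close>, the
    conditions on \<open>R\<close>, the moments of \<open>g1\<close> below \<open>n2\<close> and
    those of \<open>g2\<close> below \<open>n1\<close>.\<close>
  define I where "I = K1 <+> (K2 <+> T)"
  define E where "E = K <+> (R <+> (D n2 <+> D n1))"
  have finI: "finite I" and finE: "finite E" using fin finT finD by (auto simp: I_def E_def)
  have in_E: "Inl c \<in> E \<longleftrightarrow> c \<in> K" "Inr (Inl r) \<in> E \<longleftrightarrow> r \<in> R"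
      "Inr (Inr (Inl d)) \<in> E \<longleftrightarrow> d \<in> D n2" "Inr (Inr (Inr d)) \<in> E \<longleftrightarrow> d \<in> D n1" for c r d
    by (auto simp: E_def)
  have card: "card E < card I"
    using less \<open>card T = _\<close> fin finT finD by (simp add: I_def E_def card_Plus)
  obtain b where b: "is_lead (1, 0) (keys F2) b" using is_lead_exists_keys F(2) by metis

  define g1 where "g1 x = restrict_poly_mapping K1 (\<lambda>a. x (Inl a))" for x :: "(int \<times> int) + (int \<times> int) + (int \<times> int) \<Rightarrow> real"
  define g2 where "g2 x = restrict_poly_mapping K2 (\<lambda>a. x (Inr (Inl a)))" for x :: "(int \<times> int) + (int \<times> int) + (int \<times> int) \<Rightarrow> real"
  define s where "s x = restrict_poly_mapping T (\<lambda>a. x (Inr (Inr a)))" for x :: "(int \<times> int) + (int \<times> int) + (int \<times> int) \<Rightarrow> real"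
  have lookup_g1: "lookup (g1 x) a = (x (Inl a) when Inl a \<in> I)"
    and lookup_g2: "lookup (g2 x) a = (x (Inr (Inl a)) when Inr (Inl a) \<in> I)"
    and lookup_s: "lookup (s x) a = (x (Inr (Inr a)) when Inr (Inr a) \<in> I)" for x a
    by (auto simp: g1_def g2_def s_def I_def lookup_restrict_poly_mapping fin finT when_def)
  have keys_g: "keys (g1 x) \<subseteq> K1" "keys (g2 x) \<subseteq> K2" "keys (s x) \<subseteq> T" for x
    by (auto simp: g1_def g2_def s_def dest!: keys_restrict_poly_mapping[THEN subsetD, rotated] intro: fin finT)
  have keys_mult: "keys (F1 * g1 x) \<subseteq> K" "keys (F2 * g2 x) \<subseteq> K" for x
    by (intro keys_mult_subset; use keys_g K1 K2 in blast)+
  define L where "L e = (\<lambda>x. case e of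
      Inl c \<Rightarrow> lookup (F1 * g1 x + F2 * g2 x + s x) c
    | Inr (Inl r) \<Rightarrow> lookup (g1 x) (r + b)
    | Inr (Inr (Inl d)) \<Rightarrow> moment (g1 x) d
    | Inr (Inr (Inr d)) \<Rightarrow> moment (g2 x) d)" for e
  have lin_coord: "linear_form_on I (\<lambda>x. lookup (g1 x) a)" "linear_form_on I (\<lambda>x. lookup (g2 x) a)"
    "linear_form_on I (\<lambda>x. lookup (s x) a)" for a
    unfolding lookup_g1 lookup_g2 lookup_s by (rule linear_form_on_coord[OF finI])+
  have moment_g: "moment (g1 x) d = (\<Sum>a\<in>K1. mon d a * lookup (g1 x) a)"
    "moment (g2 x) d = (\<Sum>a\<in>K2. mon d a * lookup (g2 x) a)" for x d
    unfolding moment_eq_pairing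
    using pairing_superset[OF fin(2) keys_g(1), of "mon d" x] pairing_superset[OF fin(3) keys_g(2), of "mon d" x]
    by (simp_all add: mult.commute)
  have "linear_form_on I (L e)" for e
  proof -
    have "linear_form_on I (\<lambda>x. lookup (F1 * g1 x + F2 * g2 x + s x) c)" for c
      unfolding lookup_add lookup_mult_diff
      by (intro linear_form_on_add linear_form_on_sum linear_form_on_scale lin_coord)
    moreover have "linear_form_on I (\<lambda>x. moment (g1 x) d)" "linear_form_on I (\<lambda>x. moment (g2 x) d)" for d
      unfolding moment_g by (intro linear_form_on_sum linear_form_on_scale lin_coord)+
    ultimately show ?thesis
      by (cases e rule: sum3_cases) (simp_all add: L_def lin_coord)
  qed
  from linear_forms_common_zero[OF finE finI card, of L, OF this]
  obtain x where x: "\<exists>i\<in>I. x i \<noteq> 0" "\<And>e. e \<in> E \<Longrightarrow> L e x = 0" by blast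

  have "lookup (F1 * g1 x + F2 * g2 x + s x) c = 0" for c
  proof (cases "c \<in> K")
    case True
    then show ?thesis using x(2)[of "Inl c"] by (simp add: L_def in_E)
  next
    case False
    then have "c \<notin> keys (F1 * g1 x)" "c \<notin> keys (F2 * g2 x)" "c \<notin> keys (s x)"
      using keys_mult[of x] keys_g(3)[of x] T unfolding T_def by blast+
    then show ?thesis by (simp add: lookup_add in_keys_iff)
  qed
  then have sum0: "F1 * g1 x + F2 * g2 x + s x = 0"
    by (intro poly_mapping_eqI) simp
  \<comment> \<open>The orders are crossed: \<open>g1\<close> is paired with \<open>F1\<close> of
    order \<open>n1\<close> and \<open>g2\<close> with \<open>F2\<close> of order \<open>n2\<close>,
    so both products reach order \<open>n1 + n2\<close>.\<close>
  have "vanishes n2 (g1 x)"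
    unfolding vanishes_def using x(2)[of "Inr (Inr (Inl d))" for d] by (simp add: L_def in_E D_def)
  moreover have "vanishes n1 (g2 x)"
    unfolding vanishes_def using x(2)[of "Inr (Inr (Inr d))" for d] by (simp add: L_def in_E D_def)
  ultimately have "vanishes (n1 + n2) (F1 * g1 x + F2 * g2 x)"
    using vanishes_mult[OF van(1), of n2 "g1 x"] vanishes_mult[OF van(2), of n1 "g2 x"]
    by (intro vanishes_add) (auto simp: add.commute)
  moreover have "s x = (- 1) * (F1 * g1 x + F2 * g2 x)"
    using sum0 by (simp add: add_eq_0_iff)
  \<comment> \<open>Vanishing to order 0 is an empty condition, so the product rule shows that
    negation keeps the order.\<close>
  moreover have "vanishes 0 (- 1)" by (simp add: vanishes_def)
  ultimately have "vanishes (n1 + n2) (s x)" using vanishes_mult[of 0 "- 1"] by fastforce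
  then have s0: "s x = 0" using keys_g(3) unfolding T_def by (rule vanishes_triangle)

  have g10: "g1 x = 0"
  proof (rule ccontr)
    assume g1: "g1 x \<noteq> 0"
    have "F1 * g1 x = F2 * (- g2 x)" using sum0 s0 by (simp add: add_eq_0_iff)
    then have "F2 dvd g1 x" using syzygy by (metis dvd_triv_left)
    then obtain h where h: "g1 x = F2 * h" by blast
    then have "h \<noteq> 0" using g1 by auto
    then obtain r where r: "is_lead (1, 0) (keys h) r" using is_lead_exists_keys by metis
    have "r \<in> R" using R[OF \<open>h \<noteq> 0\<close>] keys_g(1)[of x] r by (auto simp: h is_lead_def)
    then have "lookup (g1 x) (r + b) = 0"
      using x(2)[of "Inr (Inl r)"] by (simp add: L_def in_E)
    moreover have "lookup (g1 x) (b + r) = lookup F2 b * lookup h r"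
      unfolding h by (rule lookup_mult_lead[OF _ b r]) (simp add: zero_prod_def)
    ultimately show False using is_lead_keysD[OF b] is_lead_keysD[OF r] by (simp add: add.commute)
  qed
  have "g2 x = 0" using sum0 s0 g10 F(2) by (simp add: FZ2_mult_eq_0_iff)
  have "x i = 0" if "i \<in> I" for i
  proof (cases i)
    case (Inl a)
    then show ?thesis using that lookup_g1[of x a] g10 by simp
  next
    case (Inr j)
    then show ?thesis
      using that lookup_g2[of x "projl j"] lookup_s[of x "projr j"] \<open>g2 x = 0\<close> s0 by (cases j) simp_all
  qed
  then show False using x(1) by blast
qed

section \<open>Relatively prime Laurent polynomials\<close>

text \<open>Horner evaluation at \<open>x\<close> with coefficients mapped along \<open>h\<close>;
  two nested instances give the map from bivariate polynomials to Laurent polynomials.\<close>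

definition eval_hom :: "('a::comm_ring_1 \<Rightarrow> 'b::comm_ring_1) \<Rightarrow> 'b \<Rightarrow> 'a poly \<Rightarrow> 'b" where
  "eval_hom h x p = fold_coeffs (\<lambda>a b. h a + x * b) p 0"

definition ring_hom1 :: "('a::comm_ring_1 \<Rightarrow> 'b::comm_ring_1) \<Rightarrow> bool" where
  "ring_hom1 h \<longleftrightarrow> h 1 = 1 \<and> (\<forall>a b. h (a + b) = h a + h b \<and> h (a * b) = h a * h b)"

lemma ring_hom1_0: "ring_hom1 h \<Longrightarrow> h 0 = 0"
  unfolding ring_hom1_def by (metis add_cancel_right_left add_0)

context
  fixes h :: "'a::comm_ring_1 \<Rightarrow> 'b::comm_ring_1"
  assumes h: "ring_hom1 h"
begin

lemma eval_hom_0: "eval_hom h x 0 = 0"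
  by (simp add: eval_hom_def)

lemma eval_hom_pCons: "eval_hom h x (pCons a p) = h a + x * eval_hom h x p"
  by (cases "a = 0 \<and> p = 0") (auto simp: eval_hom_def ring_hom1_0[OF h])

lemma eval_hom_add: "eval_hom h x (p + q) = eval_hom h x p + eval_hom h x q"
proof (induction p q rule: poly_induct2)
  case 0
  then show ?case by (simp add: eval_hom_0)
next
  case (pCons a p b q)
  then show ?case using h by (simp add: eval_hom_pCons ring_hom1_def algebra_simps)
qed

lemma eval_hom_smult: "eval_hom h x (smult c p) = h c * eval_hom h x p"
  using h by (induction p) (auto simp: eval_hom_0 eval_hom_pCons ring_hom1_def algebra_simps)

lemma eval_hom_mult: "eval_hom h x (p * q) = eval_hom h x p * eval_hom h x q"
  by (induction p)
     (auto simp: eval_hom_0 eval_hom_pCons eval_hom_add eval_hom_smult ring_hom1_0[OF h] algebra_simps)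

lemma ring_hom1_eval_hom: "ring_hom1 (eval_hom h x)"
proof -
  have "eval_hom h x 1 = 1"
    using h by (simp add: one_pCons eval_hom_pCons eval_hom_0 ring_hom1_def)
  then show ?thesis by (simp add: ring_hom1_def eval_hom_add eval_hom_mult)
qed

end

lemma ring_hom1_single: "ring_hom1 (single (0::'a::comm_monoid_add) :: real \<Rightarrow> _)"
  by (simp add: ring_hom1_def single_add mult_single)

definition embed1 :: "real poly \<Rightarrow> FZ2" where
  "embed1 = eval_hom (single 0) (single (1, 0) 1)"

text \<open>Its image is the subring of functions supported on the nonnegative quadrant. The source
  has gcds, which is what the divisibility argument draws on.\<close>

definition embed :: "real poly poly \<Rightarrow> FZ2" where
  "embed = eval_hom embed1 (single (0, 1) 1)"

lemma ring_hom1_embed1: "ring_hom1 embed1"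
  unfolding embed1_def by (intro ring_hom1_eval_hom ring_hom1_single)

lemma ring_hom1_embed: "ring_hom1 embed"
  unfolding embed_def by (intro ring_hom1_eval_hom ring_hom1_embed1)

lemma embed_mult: "embed (p * q) = embed p * embed q"
  using ring_hom1_embed by (simp add: ring_hom1_def)

lemma embed_add: "embed (p + q) = embed p + embed q"
  using ring_hom1_embed by (simp add: ring_hom1_def)

lemma lookup_single_mult: "lookup (single a c * f) b = c * lookup f (b - a)"
  for a b :: "int \<times> int" and c :: real
  by (cases "c = 0") (simp_all add: lookup_mult_diff)

lemma lookup_embed1: "lookup (embed1 p) (i, j) = (if j = 0 \<and> i \<ge> 0 then coeff p (nat i) else 0)"
proof (induction p arbitrary: i)
  case 0
  then show ?case by (simp add: embed1_def eval_hom_0[OF ring_hom1_single])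
next
  case (pCons a p)
  have "lookup (embed1 (pCons a p)) (i, j) = lookup (single 0 a) (i, j) + lookup (embed1 p) (i - 1, j)"
    by (simp add: embed1_def eval_hom_pCons[OF ring_hom1_single] lookup_add lookup_single_mult)
  then show ?case unfolding pCons.IH
    by (cases "i = 0") (auto simp: lookup_single zero_prod_def when_def coeff_pCons nat_diff_distrib split: nat.split)
qed

lemma lookup_embed:
  "lookup (embed p) (i, j) = (if i \<ge> 0 \<and> j \<ge> 0 then coeff (coeff p (nat j)) (nat i) else 0)"
proof (induction p arbitrary: j)
  case 0
  then show ?case by (simp add: embed_def eval_hom_0[OF ring_hom1_embed1])
next
  case (pCons a p)
  have "lookup (embed (pCons a p)) (i, j) = lookup (embed1 a) (i, j) + lookup (embed p) (i, j - 1)"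
    by (simp add: embed_def eval_hom_pCons[OF ring_hom1_embed1] lookup_add lookup_single_mult)
  then show ?case unfolding pCons.IH
    by (cases "j = 0") (auto simp: lookup_embed1 coeff_pCons nat_diff_distrib split: nat.split)
qed

lemma embed_inject: "embed p = embed q \<longleftrightarrow> p = q"
proof
  assume *: "embed p = embed q"
  have "coeff (coeff p j) i = coeff (coeff q j) i" for i j
    using arg_cong[OF *, of "\<lambda>f. lookup f (int i, int j)"] by (simp add: lookup_embed)
  then show "p = q" by (simp add: poly_eq_iff)
qed auto

lemma embed_single: "embed (monom (monom c i) j) = single (int i, int j) c"
  by (rule poly_mapping_eqI) (auto simp: lookup_embed lookup_single when_def prod_eq_iff)

lemma embed_sum: "embed (sum p I) = (\<Sum>i\<in>I. embed (p i))"
proof (induction I rule: infinite_finite_induct)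
qed (use ring_hom1_0[OF ring_hom1_embed] in \<open>auto simp: embed_add\<close>)

text \<open>A large diagonal shift makes all exponents nonnegative. Every sufficiently large
  \<open>m\<close> is covered so that two functions can be moved by the same shift.\<close>

lemma embed_shift_exists:
  fixes f :: FZ2
  shows "\<exists>M. \<forall>m\<ge>M. \<exists>F. single (m, m) 1 * f = embed F"
proof -
  define M where "M = Max (insert 0 ((\<lambda>a. max (- fst a) (- snd a)) ` keys f))"
  have "\<exists>F. single (m, m) 1 * f = embed F" if m: "m \<ge> M" for m
  proof -
    have nonneg: "0 \<le> fst a + m \<and> 0 \<le> snd a + m" if "a \<in> keys f" for a
    proof -
      have "max (- fst a) (- snd a) \<le> M" unfolding M_def using that by (intro Max_ge) auto
      then show ?thesis using m by linarith
    qed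
    define F where "F = (\<Sum>a\<in>keys f. monom (monom (lookup f a) (nat (fst a + m))) (nat (snd a + m)))"
    have "single (m, m) 1 * f = single (m, m) 1 * (\<Sum>a\<in>keys f. single a (lookup f a))"
      by (simp add: sum_single)
    also have "\<dots> = embed F"
      unfolding F_def embed_sum embed_single sum_distrib_left
      using nonneg by (intro sum.cong) (auto simp: mult_single add.commute)
    finally show ?thesis by blast
  qed
  then show ?thesis by blast
qed

text \<open>Monomials are units, with inverse at the negated exponent.\<close>

lemma dvd_single_mult_iff: "f dvd single a 1 * g \<longleftrightarrow> f dvd g"
  for f g :: FZ2
proof
  assume "f dvd single a 1 * g"
  then have "f dvd single (- a) 1 * (single a 1 * g)" by (rule dvd_mult)
  also have "single (- a) 1 * (single a 1 * g) = g"
    by (simp add: mult_single flip: mult.assoc)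
  finally show "f dvd g" .
qed (rule dvd_mult)

text \<open>Euclid's lemma is transferred from bivariate polynomials. The shifted \<open>F1\<close>
  and \<open>F2\<close> need not be coprime there, as monomials are not units, so their gcd
  \<open>D\<close> is split off; relative primality makes \<open>embed D\<close> a unit.\<close>

lemma rel_prime_dvd_mult:
  fixes f1 f2 g :: FZ2
  assumes "f1 \<noteq> 0" "rel_prime f1 f2" "f1 dvd f2 * g"
  shows "f1 dvd g"
proof -
  obtain h where h: "f2 * g = f1 * h" using assms(3) by (rule dvdE)
  obtain a F1 where F1: "single a 1 * f1 = embed F1" using embed_shift_exists by blast
  obtain b F2 where F2: "single b 1 * f2 = embed F2" using embed_shift_exists by blast
  obtain M1 where M1: "\<forall>m\<ge>M1. \<exists>G. single (m, m) 1 * (single a 1 * g) = embed G"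
    using embed_shift_exists ..
  obtain M2 where M2: "\<forall>m\<ge>M2. \<exists>H. single (m, m) 1 * (single b 1 * h) = embed H"
    using embed_shift_exists ..
  \<comment> \<open>With this common shift, \<open>F2 * G\<close> and \<open>F1 * H\<close> both
    carry the total shift \<open>a + b + c\<close>, so the relation \<open>h\<close> passes to
    polynomials.\<close>
  define c where "c = (max M1 M2, max M1 M2)"
  obtain G where G: "single c 1 * (single a 1 * g) = embed G"
    using M1 unfolding c_def by fastforce
  obtain H where H: "single c 1 * (single b 1 * h) = embed H"
    using M2 unfolding c_def by fastforce
  have "embed F2 * embed G = (single a 1 * single b 1 * single c 1) * (f2 * g)"
    unfolding F2[symmetric] G[symmetric] by (simp only: mult_ac)
  also have "\<dots> = embed F1 * embed H"
    unfolding h F1[symmetric] H[symmetric] by (simp only: mult_ac)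
  finally have FG: "F2 * G = F1 * H" by (simp add: embed_inject flip: embed_mult)
  have "single a (1::real) \<noteq> 0" by (metis lookup_single_eq lookup_zero zero_neq_one)
  then have "single a 1 * f1 \<noteq> 0" using assms(1) by (simp add: FZ2_mult_eq_0_iff)
  then have "F1 \<noteq> 0" using F1 embed_inject[of F1 0] ring_hom1_0[OF ring_hom1_embed] by auto
  then have "gcd F1 F2 \<noteq> 0" by simp
  moreover define D where "D = gcd F1 F2"
  ultimately obtain E1 E2 where E: "F1 = E1 * D" "F2 = E2 * D" "coprime E1 E2" and "D \<noteq> 0"
    using gcd_coprime_exists[of F1 F2] by blast
  have "D * (E2 * G) = D * (E1 * H)" using FG unfolding E(1,2) by (simp only: mult_ac)
  then have "E2 * G = E1 * H" using \<open>D \<noteq> 0\<close> by simp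
  then have "E1 dvd E2 * G" by simp
  then have "E1 dvd G" using E(3) by (simp add: coprime_dvd_mult_right_iff)
  then obtain S where "G = E1 * S" by (rule dvdE)
  then have "embed E1 dvd embed G" by (simp add: embed_mult)
  then have 1: "embed E1 dvd g" by (simp add: dvd_single_mult_iff flip: G)
  have "embed D dvd f1" "embed D dvd f2"
    using dvd_single_mult_iff[of "embed D" a f1] dvd_single_mult_iff[of "embed D" b f2]
    unfolding F1 F2 E(1,2) embed_mult by simp_all
  then have "embed D dvd 1" using assms(2) by (simp add: rel_prime_def)
  from mult_dvd_mono[OF 1 this] have "embed F1 dvd g" by (simp add: E(1) embed_mult)
  moreover have "f1 dvd embed F1" by (simp flip: F1)
  ultimately show ?thesis by (rule dvd_trans[rotated])
qed

text \<open>For a single factor \<open>f1\<close>, the powers of \<open>f2\<close> are stripped one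
  at a time; then each \<open>f1\<close> found in \<open>g\<close> is cancelled on both sides,
  lowering \<open>k\<close>.\<close>

lemma dvd_mult_power_cancel:
  fixes f1 f2 g :: FZ2
  assumes "f1 \<noteq> 0" "rel_prime f1 f2" "f1 ^ k dvd f2 ^ l * g"
  shows "f1 ^ k dvd g"
proof -
  have *: "f1 dvd g" if "f1 dvd f2 ^ l * g" for g
    using that
  proof (induction l)
    case (Suc l)
    then show ?case using rel_prime_dvd_mult[OF assms(1,2), of "f2 ^ l * g"] unfolding power_Suc mult.assoc by blast
  qed simp
  show ?thesis using assms(3)
  proof (induction k arbitrary: g)
    case (Suc k)
    have "f1 dvd f1 ^ Suc k" by simp
    from dvd_trans[OF this Suc.prems] have "f1 dvd g" by (rule *)
    then obtain g' where g': "g = f1 * g'" by (rule dvdE)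
    obtain h where "f2 ^ l * g = f1 ^ Suc k * h" using Suc.prems by (rule dvdE)
    then have "f1 * (f2 ^ l * g') = f1 * (f1 ^ k * h)" unfolding g' power_Suc by (simp only: mult_ac)
    then have "f1 ^ k dvd f2 ^ l * g'" by (simp add: FZ2_mult_left_cancel assms(1))
    then have "f1 ^ k dvd g'" by (rule Suc.IH)
    then show ?case unfolding g' power_Suc by (rule mult_dvd_mono[OF dvd_refl])
  qed simp
qed

section \<open>Areas of Minkowski sums with boxes\<close>

abbreviation area :: "(real \<times> real) set \<Rightarrow> real" where
  "area \<equiv> measure lebesgue"

text \<open>Nonemptiness matters: a Minkowski sum with the empty set is empty, which would break
  additivity of lengths.\<close>

definition convex_body :: "'a::euclidean_space set \<Rightarrow> bool" where
  "convex_body X \<longleftrightarrow> compact X \<and> convex X \<and> X \<noteq> {}"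

lemma convex_body_plus:
  assumes "convex_body X" "convex_body Y"
  shows "convex_body (X + Y)"
proof -
  have "X + Y = {x + y |x y. x \<in> X \<and> y \<in> Y}" by (auto simp: set_plus_def)
  then have "compact (X + Y)" using compact_sums assms by (auto simp: convex_body_def)
  moreover have "X + Y \<noteq> {}" using assms by (auto simp: convex_body_def set_plus_def)
  ultimately show ?thesis using assms by (simp add: convex_body_def convex_set_plus)
qed

lemma atLeastAtMost_plus:
  fixes a b c d :: real
  assumes "a \<le> b" "c \<le> d"
  shows "{a..b} + {c..d} = {a + c..b + d}"
proof
  show "{a + c..b + d} \<subseteq> {a..b} + {c..d}"
  proof
    fix x assume x: "x \<in> {a + c..b + d}"
    \<comment> \<open>The first summand is taken as large as possible while leaving at least
      \<open>c\<close> for the second.\<close>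
    have "x = min b (x - c) + (x - min b (x - c))" by simp
    moreover have "min b (x - c) \<in> {a..b}" "x - min b (x - c) \<in> {c..d}" using x assms by auto
    ultimately show "x \<in> {a..b} + {c..d}" by (metis set_plus_intro)
  qed
qed (auto simp: set_plus_def)

lemma convex_body_real:
  fixes X :: "real set"
  assumes "convex_body X"
  obtains a b where "X = {a..b}" "a \<le> b"
  using assms connected_compact_interval_1[of X]
  unfolding convex_body_def by (metis atLeastatMost_empty_iff convex_connected linorder_not_le)

lemma measure_plus_real:
  fixes X Y :: "real set"
  assumes "convex_body X" "convex_body Y"
  shows "measure lborel (X + Y) = measure lborel X + measure lborel Y"
proof -
  obtain a b where "X = {a..b}" "a \<le> b" using convex_body_real assms by blast
  moreover obtain c d where "Y = {c..d}" "c \<le> d" using convex_body_real assms by blast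
  ultimately show ?thesis by (simp add: atLeastAtMost_plus)
qed

text \<open>Each nonempty slice is an interval and gains length \<open>c\<close>, while empty slices
  stay empty; integrating gives \<open>c\<close> times the length of the set of nonempty
  slices.\<close>

lemma nn_integral_thicken:
  fixes C :: "real \<Rightarrow> real set"
  assumes C: "\<And>y. compact (C y)" "\<And>y. convex (C y)" and c: "0 \<le> c"
    and [measurable]: "(\<lambda>y. emeasure lborel (C y)) \<in> borel_measurable lborel" "{y. C y \<noteq> {}} \<in> sets borel"
  shows "(\<integral>\<^sup>+y. emeasure lborel (C y + {0..c}) \<partial>lborel)
    = (\<integral>\<^sup>+y. emeasure lborel (C y) \<partial>lborel) + ennreal c * emeasure lborel {y. C y \<noteq> {}}"
proof -
  have "emeasure lborel (C y + {0..c}) = emeasure lborel (C y) + ennreal c * indicator {y. C y \<noteq> {}} y" for y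
  proof (cases "C y = {}")
    case False
    then obtain a b where ab: "C y = {a..b}" "a \<le> b"
      using convex_body_real[of "C y"] C by (auto simp: convex_body_def)
    have "ennreal (b + c - a) = ennreal (b - a) + ennreal c"
      using ab(2) c by (subst ennreal_plus[symmetric]) (auto simp: algebra_simps)
    then show ?thesis using False ab c by (simp add: atLeastAtMost_plus)
  qed (simp add: set_plus_def)
  then show ?thesis by (simp add: nn_integral_add nn_integral_cmult)
qed

lemma compact_borel_prod:
  "compact X \<Longrightarrow> X \<in> sets (lborel \<Otimes>\<^sub>M lborel)" for X :: "(real \<times> real) set"
  using borel_compact[of X] unfolding lborel_prod sets_lborel .

text \<open>Connects the completed measure defining area with the Borel product measure that can be
  sliced.\<close>

lemma emeasure_compact_area: "compact X \<Longrightarrow> emeasure lborel X = ennreal (area X)"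
  for X :: "(real \<times> real) set"
  using emeasure_compact_finite[of X] borel_compact[of X]
  by (subst measure_completion) (auto simp: emeasure_eq_ennreal_measure)

definition hseg :: "real \<Rightarrow> (real \<times> real) set" where
  "hseg c = {0..c} \<times> {0}"

definition vseg :: "real \<Rightarrow> (real \<times> real) set" where
  "vseg c = {0} \<times> {0..c}"

lemma convex_body_segs: "0 \<le> c \<Longrightarrow> convex_body (hseg c)" "0 \<le> c \<Longrightarrow> convex_body (vseg c)"
  by (auto simp: convex_body_def hseg_def vseg_def compact_Times convex_Times)

lemma slice_compact_convex:
  fixes X :: "(real \<times> real) set"
  assumes "convex_body X"
  shows "compact ((\<lambda>x. (x, y)) -` X)" "convex ((\<lambda>x. (x, y)) -` X)"
    "compact (Pair y -` X)" "convex (Pair y -` X)"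
proof -
  have eq: "(\<lambda>x. (x, y)) -` X = fst ` (X \<inter> (UNIV \<times> {y}))" "Pair y -` X = snd ` (X \<inter> ({y} \<times> UNIV))"
    by force+
  have X: "compact X" "convex X" using assms by (auto simp: convex_body_def)
  show "compact ((\<lambda>x. (x, y)) -` X)" "compact (Pair y -` X)"
    unfolding eq by (intro compact_continuous_image continuous_intros compact_Int_closed X closed_Times; simp)+
  show "convex ((\<lambda>x. (x, y)) -` X)" "convex (Pair y -` X)"
    unfolding eq by (intro convex_linear_image linear_fst linear_snd convex_Int X convex_Times; simp)+
qed

lemma convex_body_projections:
  fixes X :: "(real \<times> real) set"
  assumes "convex_body X"
  shows "convex_body (fst ` X)" "convex_body (snd ` X)"
  using assms unfolding convex_body_def
  by (auto intro!: compact_continuous_image continuous_intros convex_linear_image linear_fst linear_snd)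

lemma projections_plus: "fst ` (X + Y) = fst ` X + fst ` Y" "snd ` (X + Y) = snd ` X + snd ` Y"
  by (force simp: set_plus_def image_iff)+

lemma area_plus_hseg:
  assumes X: "convex_body X" and c: "0 \<le> c"
  shows "area (X + hseg c) = area X + c * measure lborel (snd ` X)"
proof -
  define C where "C = (\<lambda>y. (\<lambda>x. (x, y)) -` X)"
  have XH: "convex_body (X + hseg c)" using X c convex_body_plus convex_body_segs by blast
  have cpt: "compact X" "compact (X + hseg c)" "compact (snd ` X)"
    using X XH convex_body_projections by (auto simp: convex_body_def)
  have W: "{y. C y \<noteq> {}} = snd ` X" by (force simp: C_def)
  have sl: "(\<lambda>x. (x, y)) -` (X + hseg c) = C y + {0..c}" for y
    by (force simp: C_def hseg_def set_plus_def)
  have m: "(\<lambda>y. emeasure lborel (C y)) \<in> borel_measurable lborel"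
    unfolding C_def by (rule lborel_pair.measurable_emeasure_Pair2) (rule compact_borel_prod[OF cpt(1)])
  have "ennreal (area (X + hseg c)) = (\<integral>\<^sup>+y. emeasure lborel (C y + {0..c}) \<partial>lborel)"
    using lborel_pair.emeasure_pair_measure_alt2[OF compact_borel_prod[OF cpt(2)]]
    by (simp add: lborel_prod sl emeasure_compact_area cpt)
  also have "\<dots> = (\<integral>\<^sup>+y. emeasure lborel (C y) \<partial>lborel) + ennreal c * emeasure lborel (snd ` X)"
    unfolding W[symmetric]
    by (rule nn_integral_thicken)
       (use slice_compact_convex[OF X] c m W borel_compact[OF cpt(3)] in \<open>auto simp: C_def\<close>)
  also have "(\<integral>\<^sup>+y. emeasure lborel (C y) \<partial>lborel) = ennreal (area X)"
    using lborel_pair.emeasure_pair_measure_alt2[OF compact_borel_prod[OF cpt(1)]]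
    by (simp add: lborel_prod C_def emeasure_compact_area cpt)
  also have "emeasure lborel (snd ` X) = ennreal (measure lborel (snd ` X))"
    using emeasure_compact_finite[OF cpt(3)] by (simp add: emeasure_eq_ennreal_measure)
  finally show ?thesis using c by (simp flip: ennreal_mult ennreal_plus)
qed

lemma area_plus_vseg:
  assumes X: "convex_body X" and c: "0 \<le> c"
  shows "area (X + vseg c) = area X + c * measure lborel (fst ` X)"
proof -
  define C where "C = (\<lambda>y. Pair y -` X)"
  have XV: "convex_body (X + vseg c)" using X c convex_body_plus convex_body_segs by blast
  have cpt: "compact X" "compact (X + vseg c)" "compact (fst ` X)"
    using X XV convex_body_projections by (auto simp: convex_body_def)
  have W: "{y. C y \<noteq> {}} = fst ` X" by (force simp: C_def)
  have sl: "Pair y -` (X + vseg c) = C y + {0..c}" for y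
    by (force simp: C_def vseg_def set_plus_def)
  have m: "(\<lambda>y. emeasure lborel (C y)) \<in> borel_measurable lborel"
    unfolding C_def by (rule lborel.measurable_emeasure_Pair) (rule compact_borel_prod[OF cpt(1)])
  have "ennreal (area (X + vseg c)) = (\<integral>\<^sup>+y. emeasure lborel (C y + {0..c}) \<partial>lborel)"
    using lborel.emeasure_pair_measure_alt[OF compact_borel_prod[OF cpt(2)]]
    by (simp add: lborel_prod sl emeasure_compact_area cpt)
  also have "\<dots> = (\<integral>\<^sup>+y. emeasure lborel (C y) \<partial>lborel) + ennreal c * emeasure lborel (fst ` X)"
    unfolding W[symmetric]
    by (rule nn_integral_thicken)
       (use slice_compact_convex[OF X] c m W borel_compact[OF cpt(3)] in \<open>auto simp: C_def\<close>)
  also have "(\<integral>\<^sup>+y. emeasure lborel (C y) \<partial>lborel) = ennreal (area X)"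
    using lborel.emeasure_pair_measure_alt[OF compact_borel_prod[OF cpt(1)]]
    by (simp add: lborel_prod C_def emeasure_compact_area cpt)
  also have "emeasure lborel (fst ` X) = ennreal (measure lborel (fst ` X))"
    using emeasure_compact_finite[OF cpt(3)] by (simp add: emeasure_eq_ennreal_measure)
  finally show ?thesis using c by (simp flip: ennreal_mult ennreal_plus)
qed

text \<open>At \<open>R = {0}\<close> this is \<open>2 * mixed_volume P Q\<close>. A general
  \<open>R\<close> is carried along because the dimension count needs room beyond
  \<open>P + Q\<close>.\<close>

definition mixed_difference :: "(real \<times> real) set \<Rightarrow> (real \<times> real) set \<Rightarrow> (real \<times> real) set \<Rightarrow> real" where
  "mixed_difference P Q R = area (P + Q + R) - area (P + R) - area (Q + R) + area R"

text \<open>Adding a segment increases an area by \<open>c\<close> times the length of a projection.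
  These lengths are additive under Minkowski sums, so the four increments cancel.\<close>

lemma mixed_difference_segs:
  assumes "convex_body P" "convex_body Q" "convex_body R" "0 \<le> c"
  shows "mixed_difference P Q (R + hseg c) = mixed_difference P Q R"
    "mixed_difference P Q (R + vseg c) = mixed_difference P Q R"
proof -
  note cb = convex_body_plus[OF convex_body_plus[OF assms(1,2)] assms(3)]
    convex_body_plus[OF assms(1,3)] convex_body_plus[OF assms(2,3)] assms(3)
  note pr = assms(1-3)[THEN convex_body_projections(1)] assms(1-3)[THEN convex_body_projections(2)]
  show "mixed_difference P Q (R + hseg c) = mixed_difference P Q R"
    unfolding mixed_difference_def add.assoc[symmetric]
    by (simp add: area_plus_hseg cb assms(4) projections_plus measure_plus_real convex_body_plus pr distrib_left)
  show "mixed_difference P Q (R + vseg c) = mixed_difference P Q R"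
    unfolding mixed_difference_def add.assoc[symmetric]
    by (simp add: area_plus_vseg cb assms(4) projections_plus measure_plus_real convex_body_plus pr distrib_left)
qed

lemma box_eq: "hseg c + vseg c = {0..c} \<times> {0..c}"
  by (force simp: hseg_def vseg_def set_plus_def)

lemma mixed_difference_box:
  assumes "convex_body P" "convex_body Q" "0 \<le> c"
  shows "mixed_difference P Q ({0..c} \<times> {0..c}) = 2 * mixed_volume P Q"
proof -
  \<comment> \<open>Here \<open>0\<close> is the set containing only the origin; the box arises from
    it by adding one horizontal and one vertical segment.\<close>
  have "convex_body (0 :: (real \<times> real) set)" by (simp add: convex_body_def set_zero)
  from mixed_difference_segs(1)[OF assms(1,2) this assms(3)]
  have "mixed_difference P Q (hseg c) = mixed_difference P Q 0" by simp
  moreover have "area 0 = 0" by (simp add: set_zero)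
  ultimately show ?thesis
    using mixed_difference_segs(2)[OF assms(1,2) convex_body_segs(1)[OF assms(3)] assms(3)]
    by (simp add: box_eq mixed_difference_def mixed_volume_def)
qed

section \<open>Lattice points in dilated convex sets\<close>

definition real_pair :: "int \<times> int \<Rightarrow> real \<times> real" where
  "real_pair a = (real_of_int (fst a), real_of_int (snd a))"

text \<open>The dilation is an image rather than a division so that \<open>k = 0\<close> yields just
  the origin for nonempty \<open>X\<close>, the base case for powers.\<close>

definition lattice_points :: "nat \<Rightarrow> (real \<times> real) set \<Rightarrow> (int \<times> int) set" where
  "lattice_points k X = {a. real_pair a \<in> (\<lambda>x. real k *\<^sub>R x) ` X}"

lemma real_pair_add: "real_pair (a + b) = real_pair a + real_pair b"
  by (simp add: real_pair_def)

lemma lattice_points_iff: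
  "0 < k \<Longrightarrow> a \<in> lattice_points k X \<longleftrightarrow> (real_of_int (fst a) / real k, real_of_int (snd a) / real k) \<in> X"
  unfolding lattice_points_def real_pair_def by (force simp: image_iff)

lemma finite_lattice_points:
  assumes "bounded X"
  shows "finite (lattice_points k X)"
proof -
  have "bounded ((\<lambda>x. real k *\<^sub>R x) ` X)" using assms by (rule bounded_scaling)
  then obtain M where M: "\<And>x. x \<in> (\<lambda>x. real k *\<^sub>R x) ` X \<Longrightarrow> norm x \<le> M"
    unfolding bounded_iff by blast
  have "a \<in> {- \<lceil>M\<rceil>..\<lceil>M\<rceil>} \<times> {- \<lceil>M\<rceil>..\<lceil>M\<rceil>}" if "a \<in> lattice_points k X" for a
  proof -
    have "norm (real_pair a) \<le> M" using that M by (auto simp: lattice_points_def)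
    then have "\<bar>real_of_int (fst a)\<bar> \<le> M" "\<bar>real_of_int (snd a)\<bar> \<le> M"
      using norm_fst_le[of "real_of_int (fst a)" "real_of_int (snd a)"]
        norm_snd_le[of "real_of_int (snd a)" "real_of_int (fst a)"] by (auto simp: real_pair_def)
    then show ?thesis by (cases a) (simp, linarith)
  qed
  then have "lattice_points k X \<subseteq> {- \<lceil>M\<rceil>..\<lceil>M\<rceil>} \<times> {- \<lceil>M\<rceil>..\<lceil>M\<rceil>}" by (rule subsetI)
  then show ?thesis by (rule finite_subset) simp
qed

lemma lattice_points_add:
  "a \<in> lattice_points k X \<Longrightarrow> b \<in> lattice_points k Y \<Longrightarrow> a + b \<in> lattice_points k (X + Y)"
  unfolding lattice_points_def real_pair_add mem_Collect_eq
  by (elim imageE) (metis imageI scaleR_add_right set_plus_intro)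

definition grid_round :: "nat \<Rightarrow> real \<times> real \<Rightarrow> real \<times> real" where
  "grid_round k x = (of_int \<lfloor>real k * fst x\<rfloor> / real k, of_int \<lfloor>real k * snd x\<rfloor> / real k)"

lemma grid_round_bounds:
  assumes "0 < k"
  shows "fst (grid_round k x) \<le> fst x" "fst x \<le> fst (grid_round k x) + 1 / real k"
    "snd (grid_round k x) \<le> snd x" "snd x \<le> snd (grid_round k x) + 1 / real k"
proof -
  have *: "of_int \<lfloor>real k * t\<rfloor> / real k \<le> t \<and> t \<le> of_int \<lfloor>real k * t\<rfloor> / real k + 1 / real k" for t
  proof -
    have "of_int \<lfloor>real k * t\<rfloor> \<le> real k * t" "real k * t \<le> of_int \<lfloor>real k * t\<rfloor> + 1" by linarith+
    then show ?thesis using assms by (simp add: field_simps)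
  qed
  show "fst (grid_round k x) \<le> fst x" "fst x \<le> fst (grid_round k x) + 1 / real k"
    "snd (grid_round k x) \<le> snd x" "snd x \<le> snd (grid_round k x) + 1 / real k"
    using * by (auto simp: grid_round_def)
qed

lemma grid_round_tendsto: "(\<lambda>k. grid_round (Suc k) x) \<longlonglongrightarrow> x"
proof -
  have inv: "(\<lambda>k. 1 / real (Suc k)) \<longlonglongrightarrow> 0" using LIMSEQ_inverse_real_of_nat by (simp add: inverse_eq_divide)
  have lim: "(\<lambda>k. t - 1 / real (Suc k)) \<longlonglongrightarrow> t" for t using tendsto_diff[OF tendsto_const inv, of t] by simp
  have "(\<lambda>k. fst (grid_round (Suc k) x)) \<longlonglongrightarrow> fst x" "(\<lambda>k. snd (grid_round (Suc k) x)) \<longlonglongrightarrow> snd x"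
    using grid_round_bounds[of "Suc k" x for k]
    by (intro tendsto_sandwich[OF _ _ lim tendsto_const] always_eventually; simp add: algebra_simps)+
  from tendsto_Pair[OF this] show ?thesis by simp
qed

text \<open>The points rounding to a given grid point form a half-open square of area
  \<open>1 / k^2\<close>, and grid points in \<open>X\<close> correspond to lattice points of its
  dilation.\<close>

lemma area_grid_round:
  assumes "bounded X" "0 < k"
  shows "grid_round k -` X \<in> sets borel" "area (grid_round k -` X) = real (card (lattice_points k X)) / (real k)\<^sup>2"
proof -
  define I where "I = (\<lambda>i. {real_of_int i / real k..<(real_of_int i + 1) / real k})"
  define cell where "cell = (\<lambda>a. I (fst a) \<times> I (snd a))"
  have I: "t \<in> I i \<longleftrightarrow> \<lfloor>real k * t\<rfloor> = i" for t i
    using assms(2) by (auto simp: I_def field_simps floor_eq_iff)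
  have cell: "x \<in> cell a \<longleftrightarrow> a = (\<lfloor>real k * fst x\<rfloor>, \<lfloor>real k * snd x\<rfloor>)" for x a
    by (cases a) (auto simp: cell_def I mem_Times_iff)
  have eq: "grid_round k -` X = (\<Union>a\<in>lattice_points k X. cell a)"
    using assms(2) by (auto simp: cell lattice_points_iff grid_round_def)
  have fin: "finite (lattice_points k X)" using assms(1) by (rule finite_lattice_points)
  have len: "emeasure lborel (I i) = ennreal (1 / real k)" for i
    using assms(2) by (simp add: I_def field_simps)
  have [measurable]: "I i \<in> sets borel" for i by (simp add: I_def)
  have em: "emeasure lborel (cell a) = ennreal (1 / (real k)\<^sup>2)" for a
  proof -
    have "emeasure (lborel \<Otimes>\<^sub>M lborel) (cell a) = ennreal (1 / real k) * ennreal (1 / real k)"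
      unfolding cell_def by (subst lborel.emeasure_pair_measure_Times) (auto simp: len)
    then show ?thesis by (simp add: lborel_prod power2_eq_square flip: ennreal_mult)
  qed
  have sets: "cell a \<in> sets borel" for a
    unfolding cell_def by (simp add: borel_Times)
  show "grid_round k -` X \<in> sets borel" unfolding eq using fin sets by (intro sets.finite_UN) auto
  then have "area (grid_round k -` X) = measure lborel (\<Union>a\<in>lattice_points k X. cell a)"
    by (simp add: eq)
  also have "\<dots> = (\<Sum>a\<in>lattice_points k X. measure lborel (cell a))"
    using fin sets by (intro measure_finite_Union) (auto simp: em disjoint_family_on_def cell)
  also have "\<dots> = real (card (lattice_points k X)) / (real k)\<^sup>2"
    by (simp add: measure_def em)
  finally show "area (grid_round k -` X) = real (card (lattice_points k X)) / (real k)\<^sup>2" .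
qed

text \<open>Dominated convergence: off the frontier of \<open>X\<close>, a point and its roundings
  eventually agree about membership in \<open>X\<close>, and the frontier of a convex set is
  negligible.\<close>

lemma lattice_points_asymptotics:
  assumes X: "compact X" "convex X"
  shows "(\<lambda>k. real (card (lattice_points (Suc k) X)) / (real (Suc k))\<^sup>2) \<longlonglongrightarrow> area X"
proof -
  have bdd: "bounded X" using X(1) by (rule compact_imp_bounded)
  then obtain M where M: "\<And>x. x \<in> X \<Longrightarrow> norm x \<le> M" by (auto simp: bounded_iff)
  \<comment> \<open>Rounding down lowers a coordinate by at most \<open>1 / Suc k \<le> 1\<close>,
    hence the extra 1 at the upper corner.\<close>
  define B where "B = cbox (- M, - M) (M + 1, M + 1)"
  define A where "A = (\<lambda>k. grid_round (Suc k) -` X)"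
  have sets: "A k \<in> sets lebesgue" for k unfolding A_def using area_grid_round(1)[OF bdd] by simp
  have setX: "X \<in> sets lebesgue" using borel_compact[OF X(1)] by simp
  have sub: "A k \<subseteq> B" for k
  proof
    fix x assume x: "x \<in> A k"
    have "norm (grid_round (Suc k) x) \<le> M" using x M by (simp add: A_def)
    then have "\<bar>fst (grid_round (Suc k) x)\<bar> \<le> M" "\<bar>snd (grid_round (Suc k) x)\<bar> \<le> M"
      using norm_fst_le[of "fst (grid_round (Suc k) x)" "snd (grid_round (Suc k) x)"]
        norm_snd_le[of "snd (grid_round (Suc k) x)" "fst (grid_round (Suc k) x)"] by auto
    moreover have "1 / real (Suc k) \<le> 1" by simp
    ultimately show "x \<in> B"
      using grid_round_bounds[of "Suc k" x]
      unfolding B_def cbox_Pair_eq mem_Times_iff by (simp only: fst_conv snd_conv mem_box_real) linarith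
  qed
  have "(\<lambda>k. integral\<^sup>L lebesgue (indicat_real (A k))) \<longlonglongrightarrow> integral\<^sup>L lebesgue (indicat_real X)"
  proof (rule integral_dominated_convergence[where w = "indicat_real B"])
    have "negligible (frontier X)" using X(2) by (rule negligible_convex_frontier)
    then have "AE x in lebesgue. x \<notin> frontier X"
      by (auto simp: negligible_iff_null_sets intro: AE_not_in)
    moreover have "(\<lambda>k. indicat_real (A k) x) \<longlonglongrightarrow> indicat_real X x" if "x \<notin> frontier X" for x
    proof (cases "x \<in> X")
      case True
      then have "x \<in> interior X" using that closure_subset by (auto simp: frontier_def)
      from topological_tendstoD[OF grid_round_tendsto open_interior this]
      have "eventually (\<lambda>k. grid_round (Suc k) x \<in> X) sequentially"
        by (rule eventually_mono) (use interior_subset in blast)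
      then show ?thesis
        by (intro tendsto_eventually) (auto elim!: eventually_mono simp: True A_def)
    next
      case False
      then have "x \<in> - X" "open (- X)" using X(1) compact_imp_closed by auto
      from topological_tendstoD[OF grid_round_tendsto this(2,1)]
      show ?thesis
        by (intro tendsto_eventually) (auto elim!: eventually_mono simp: False A_def)
    qed
    ultimately show "AE x in lebesgue. (\<lambda>k. indicat_real (A k) x) \<longlonglongrightarrow> indicat_real X x"
      by (rule eventually_mono)
    show "AE x in lebesgue. norm (indicat_real (A k) x) \<le> indicat_real B x" for k
      using sub by (auto simp: indicator_def)
    show "integrable lebesgue (indicat_real B)"
      using lmeasurable_compact[of B] by (simp add: B_def fmeasurable_def)
  qed (use sets setX in \<open>auto intro: borel_measurable_indicator\<close>)
  then have "(\<lambda>k. area (A k)) \<longlonglongrightarrow> area X" by simp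
  then show ?thesis unfolding A_def using area_grid_round(2)[OF bdd] by simp
qed

section \<open>Newton polytopes of powers\<close>

lemma newton_polytope_eq: "newton_polytope f = convex hull (real_pair ` keys f)"
  by (simp add: newton_polytope_def real_pair_def)

lemma convex_body_newton_polytope:
  assumes "f \<noteq> 0"
  shows "convex_body (newton_polytope f)"
  using assms by (auto simp: convex_body_def newton_polytope_eq intro!: finite_imp_compact_convex_hull)

lemma real_pair_in_newton_polytope: "a \<in> keys f \<Longrightarrow> real_pair a \<in> newton_polytope f"
  by (simp add: newton_polytope_eq hull_inc)

text \<open>By convexity, the polytope plus its \<open>k\<close>-fold dilation lies in the
  \<open>Suc k\<close>-fold dilation.\<close>

lemma keys_power_subset:
  assumes "f \<noteq> 0"
  shows "keys (f ^ k) \<subseteq> lattice_points k (newton_polytope f)"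
proof (induction k)
  case 0
  have "newton_polytope f \<noteq> {}" using convex_body_newton_polytope[OF assms] by (simp add: convex_body_def)
  then show ?case by (auto simp: lattice_points_def real_pair_def image_iff zero_prod_def)
next
  case (Suc k)
  have "convex (newton_polytope f)" by (simp add: newton_polytope_eq)
  have "a + b \<in> lattice_points (Suc k) (newton_polytope f)"
    if ab: "a \<in> keys f" "b \<in> keys (f ^ k)" for a b
  proof -
    obtain y where y: "y \<in> newton_polytope f" "real_pair b = real k *\<^sub>R y"
      using Suc ab(2) by (auto simp: lattice_points_def)
    define x where "x = (1 / real (Suc k)) *\<^sub>R real_pair a + (real k / real (Suc k)) *\<^sub>R y"
    have "x \<in> newton_polytope f"
      unfolding x_def
      by (rule convexD[OF \<open>convex (newton_polytope f)\<close>])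
         (use y real_pair_in_newton_polytope ab(1) in \<open>auto simp: field_simps\<close>)
    moreover have "real_pair (a + b) = real (Suc k) *\<^sub>R x"
      unfolding x_def scaleR_add_right scaleR_scaleR real_pair_add y(2) by simp
    ultimately show ?thesis by (auto simp: lattice_points_def)
  qed
  then show ?case unfolding power_Suc by (rule keys_mult_subset)
qed

definition real_lin :: "int \<times> int \<Rightarrow> real \<times> real \<Rightarrow> real" where
  "real_lin u x = real_of_int (fst u) * fst x + real_of_int (snd u) * snd x"

lemma real_lin_real_pair: "real_lin u (real_pair a) = real_of_int (lin u a)"
  by (simp add: real_lin_def real_pair_def lin_def)

lemma real_lin_add: "real_lin u (x + y) = real_lin u x + real_lin u y"
  and real_lin_scaleR: "real_lin u (r *\<^sub>R x) = r * real_lin u x"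
  by (simp_all add: real_lin_def algebra_simps)

lemma real_lin_newton_polytope:
  assumes "x \<in> newton_polytope f"
  shows "real_lin u x \<le> real_of_int (support_max u f)"
proof -
  have "convex {x. real_lin u x \<le> real_of_int (support_max u f)}"
    by (rule convexI)
       (auto simp: real_lin_add real_lin_scaleR intro!: convex_bound_le)
  moreover have "real_pair ` keys f \<subseteq> {x. real_lin u x \<le> real_of_int (support_max u f)}"
  proof (rule image_subsetI)
    fix a assume "a \<in> keys f"
    then show "real_pair a \<in> {x. real_lin u x \<le> real_of_int (support_max u f)}"
      unfolding mem_Collect_eq real_lin_real_pair of_int_le_iff by (rule support_max_ge)
  qed
  ultimately have "newton_polytope f \<subseteq> {x. real_lin u x \<le> real_of_int (support_max u f)}"
    unfolding newton_polytope_eq by (rule hull_minimal[rotated])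
  then show ?thesis using assms by blast
qed

text \<open>Support maxima add under multiplication, so the share \<open>k * support_max u f\<close>
  of \<open>f ^ k\<close> cancels and \<open>B\<close> alone bounds \<open>h\<close>.\<close>

lemma support_max_quotient:
  assumes f: "f \<noteq> 0" "h \<noteq> 0" "u \<noteq> 0"
    and sub: "keys (f ^ k * h) \<subseteq> lattice_points k (newton_polytope f + B)"
    and B: "\<And>x. x \<in> B \<Longrightarrow> real_lin u x \<le> real_of_int \<beta>"
    and a: "a \<in> keys h"
  shows "lin u a \<le> int k * \<beta>"
proof -
  have fk: "f ^ k \<noteq> 0" using f(1) by (rule FZ2_power_eq_0_iff)
  have "support_max u (f ^ k * h) \<le> int k * support_max u f + int k * \<beta>"
  proof (rule support_max_le)
    show "f ^ k * h \<noteq> 0" using fk f(2) by (simp add: FZ2_mult_eq_0_iff)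
    fix c assume "c \<in> keys (f ^ k * h)"
    then obtain x y where xy: "x \<in> newton_polytope f" "y \<in> B" "real_pair c = real k *\<^sub>R (x + y)"
      using sub by (fastforce simp: lattice_points_def set_plus_def)
    have "real_of_int (lin u c) = real k * (real_lin u x + real_lin u y)"
      by (simp add: real_lin_real_pair[symmetric] xy(3) real_lin_add real_lin_scaleR)
    also have "\<dots> \<le> real k * (real_of_int (support_max u f) + real_of_int \<beta>)"
      using real_lin_newton_polytope[OF xy(1)] B[OF xy(2)] by (intro mult_left_mono add_mono) auto
    also have "\<dots> = real_of_int (int k * support_max u f + int k * \<beta>)" by (simp add: algebra_simps)
    finally show "lin u c \<le> int k * support_max u f + int k * \<beta>" by (simp only: of_int_le_iff)
  qed
  then have "support_max u h \<le> int k * \<beta>"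
    using support_max_mult[OF fk f(2,3)] support_max_power[OF f(1,3)] by simp
  then show ?thesis using support_max_ge[OF a, of u] by linarith
qed

text \<open>The dimension count is applied to \<open>k\<close>-th powers, whose orders of vanishing
  and Newton polytopes scale by \<open>k\<close>.\<close>

lemma lattice_count_bound:
  fixes f1 f2 :: FZ2
  assumes f: "f1 \<noteq> 0" "f2 \<noteq> 0" "rel_prime f1 f2" and k: "0 < k"
  defines "m1 \<equiv> exp_deg (sm f1)" and "m2 \<equiv> exp_deg (sm f2)"
  defines "P \<equiv> newton_polytope f1" and "Q \<equiv> newton_polytope f2"
  defines "B \<equiv> {0..real (m1 + m2)} \<times> {0..real (m1 + m2)}"
  shows "card (lattice_points k (Q + B)) + card (lattice_points k (P + B)) + (k * m1) * (k * m2)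
    \<le> card (lattice_points k (P + Q + B)) + card (lattice_points k B)"
proof -
  have PQ: "convex_body P" "convex_body Q" using f convex_body_newton_polytope by (auto simp: P_def Q_def)
  have B: "convex_body B"
    using convex_body_plus[OF convex_body_segs, of "real (m1 + m2)" "real (m1 + m2)"]
    by (simp add: box_eq B_def)
  have fin: "finite (lattice_points k X)" if "convex_body X" for X
    using that by (intro finite_lattice_points compact_imp_bounded) (simp add: convex_body_def)
  obtain a1 a2 where a: "a1 \<in> keys f1" "a2 \<in> keys f2" using f by (metis keys_eq_empty equals0I)
  define t where "t = (int k * (fst a1 + fst a2), int k * (snd a1 + snd a2))"
  show ?thesis
  proof (rule ideal_dimension_count)
    show "f1 ^ k \<noteq> 0" "f2 ^ k \<noteq> 0" using f FZ2_power_eq_0_iff by auto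
    have "rel_prime f2 f1" using f(3) by (auto simp: rel_prime_def)
    then show "f2 ^ k dvd g" if "f2 ^ k dvd f1 ^ k * g" for g
      using dvd_mult_power_cancel[OF f(2) _ that] by blast
    show "vanishes (k * m1) (f1 ^ k)" "vanishes (k * m2) (f2 ^ k)"
      using f unfolding m1_def m2_def by (auto intro: vanishes_power vanishes_sm)
    show "finite (lattice_points k (P + Q + B))" "finite (lattice_points k (Q + B))"
      "finite (lattice_points k (P + B))" "finite (lattice_points k B)"
      using PQ B by (auto intro!: fin convex_body_plus)
    show "a + b \<in> lattice_points k (P + Q + B)"
      if "a \<in> keys (f1 ^ k)" "b \<in> lattice_points k (Q + B)" for a b
      using lattice_points_add[of a k P b "Q + B"] that keys_power_subset[OF f(1), of k]
      by (auto simp: P_def add.assoc)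
    show "a + b \<in> lattice_points k (P + Q + B)"
      if "a \<in> keys (f2 ^ k)" "b \<in> lattice_points k (P + B)" for a b
      using lattice_points_add[of a k Q b "P + B"] that keys_power_subset[OF f(2), of k]
      by (auto simp: Q_def add_ac)
    show "keys h \<subseteq> lattice_points k B"
      if h: "h \<noteq> 0" "keys (f2 ^ k * h) \<subseteq> lattice_points k (Q + B)" for h
    proof
      fix a assume a: "a \<in> keys h"
      note bound = support_max_quotient[OF f(2) h(1) _ h(2)[unfolded Q_def] _ a]
      \<comment> \<open>A box is cut out by its bounds in the four coordinate directions, so these
        already place \<open>h\<close> in the dilated \<open>B\<close>.\<close>
      have "lin (1, 0) a \<le> int k * int (m1 + m2)" "lin (0, 1) a \<le> int k * int (m1 + m2)"
        "lin (- 1, 0) a \<le> int k * 0" "lin (0, - 1) a \<le> int k * 0"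
        by (rule bound; auto simp: real_lin_def B_def zero_prod_def)+
      then have *: "0 \<le> fst a" "fst a \<le> int k * int (m1 + m2)" "0 \<le> snd a" "snd a \<le> int k * int (m1 + m2)"
        by (auto simp: lin_def)
      have "real_of_int (fst a) \<le> real k * real (m1 + m2)" "real_of_int (snd a) \<le> real k * real (m1 + m2)"
        using *(2,4) by (metis of_int_le_iff of_int_mult of_int_of_nat_eq)+
      then show "a \<in> lattice_points k B"
        using k * by (auto simp: lattice_points_iff B_def field_simps)
    qed
    show "triangle t (k * m1 + k * m2) \<subseteq> lattice_points k (P + Q + B)"
    proof
      fix x assume "x \<in> triangle t (k * m1 + k * m2)"
      then obtain i j where x: "x = t + (int i, int j)" and ij: "i + j < k * m1 + k * m2"
        unfolding triangle_def by (force simp: prod_eq_iff)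
      \<comment> \<open>The side of \<open>B\<close> is chosen for this: after division by
        \<open>k\<close>, the offsets in the triangle sum to less than
        \<open>m1 + m2\<close>.\<close>
      have "real (i + j) \<le> real (k * m1 + k * m2)" using ij by linarith
      then have "(real i / real k, real j / real k) \<in> B"
        using k by (auto simp: B_def field_simps)
      then have "(int i, int j) \<in> lattice_points k B" using k by (simp add: lattice_points_iff)
      moreover have "t \<in> lattice_points k (P + Q)"
      proof -
        have "real_pair t = real k *\<^sub>R (real_pair a1 + real_pair a2)"
          by (simp add: t_def real_pair_def)
        moreover have "real_pair a1 + real_pair a2 \<in> P + Q"
          using a unfolding P_def Q_def by (intro set_plus_intro real_pair_in_newton_polytope)
        ultimately show ?thesis by (auto simp: lattice_points_def)
      qed
      ultimately show "x \<in> lattice_points k (P + Q + B)" unfolding x by (intro lattice_points_add)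
    qed
  qed
qed

theorem theorem16:
  fixes f1 f2 :: "(int \<times> int) \<Rightarrow>\<^sub>0 real"
  assumes "f1 \<noteq> 0" and "f2 \<noteq> 0" and "rel_prime f1 f2"
  shows "real (exp_deg (sm f1)) * real (exp_deg (sm f2))
           \<le> 2 * mixed_volume (newton_polytope f1) (newton_polytope f2)"
proof -
  define m1 m2 where "m1 = exp_deg (sm f1)" and "m2 = exp_deg (sm f2)"
  define P Q where "P = newton_polytope f1" and "Q = newton_polytope f2"
  define B where "B = {0..real (m1 + m2)} \<times> {0..real (m1 + m2)}"
  have PQ: "convex_body P" "convex_body Q"
    using assms convex_body_newton_polytope by (auto simp: P_def Q_def)
  have B: "convex_body B"
    using convex_body_plus[OF convex_body_segs, of "real (m1 + m2)" "real (m1 + m2)"]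
    by (simp add: box_eq B_def)
  define N where "N X k = real (card (lattice_points (Suc k) X)) / (real (Suc k))\<^sup>2" for X k
  have N: "N X \<longlonglongrightarrow> area X" if "convex_body X" for X
    using lattice_points_asymptotics[of X] that by (simp add: convex_body_def N_def[abs_def])
  \<comment> \<open>The four normalized counts tend to the four areas, so the inequality for each
    \<open>k\<close> passes to the limit.\<close>
  have "(\<lambda>k. N (P + Q + B) k - N (P + B) k - N (Q + B) k + N B k) \<longlonglongrightarrow> mixed_difference P Q B"
    unfolding mixed_difference_def
    by (intro tendsto_add tendsto_diff N convex_body_plus PQ B)
  moreover have "real m1 * real m2 \<le> N (P + Q + B) k - N (P + B) k - N (Q + B) k + N B k" for k
  proof -
    let ?c = "\<lambda>X. real (card (lattice_points (Suc k) X))"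
    have "?c (Q + B) + ?c (P + B) + (real (Suc k) * real m1) * (real (Suc k) * real m2) \<le> ?c (P + Q + B) + ?c B"
      using lattice_count_bound[OF assms, of "Suc k"]
      unfolding P_def Q_def B_def m1_def m2_def
      by (simp only: of_nat_le_iff flip: of_nat_add of_nat_mult)
    then have "real m1 * real m2 * (real (Suc k))\<^sup>2 \<le> ?c (P + Q + B) - ?c (P + B) - ?c (Q + B) + ?c B"
      by (simp add: power2_eq_square algebra_simps)
    then have "real m1 * real m2 \<le> (?c (P + Q + B) - ?c (P + B) - ?c (Q + B) + ?c B) / (real (Suc k))\<^sup>2"
      by (subst pos_le_divide_eq) auto
    then show ?thesis by (simp add: N_def diff_divide_distrib add_divide_distrib)
  qed
  ultimately have "real m1 * real m2 \<le> mixed_difference P Q B"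
    by (intro LIMSEQ_le_const) auto
  also have "\<dots> = 2 * mixed_volume P Q"
    unfolding B_def by (rule mixed_difference_box) (use PQ in auto)
  finally show ?thesis by (simp add: m1_def m2_def P_def Q_def)
qed

end
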